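(* Assume: (1) there exist $w_0\in\mathcal K$ and $\epsilon_0\ge 0$ such that $F(w_0)-F_*\le\epsilon_0$; (2) there is a constant $G$ such that $\|\partial f(w;\xi)\|_2\le G$; (3) for a target accuracy $\epsilon\ll1$ there are constants $c>0$ and $\theta\in(0,1]$ such that $\|w-w_*\|_2\le c\,(F(w)-F_* )^{\theta}$ for all $w\in\mathcal S_\epsilon$, where $w_*$ is the point of $\mathcal K_*$ closest to $w$. Given $\delta\in(0,1)$, let $\tilde\delta=\delta/K$, $K=\lceil\log_2(\epsilon_0/\epsilon)\rceil$, $D_1\ge \frac{c\epsilon_0}{\epsilon^{1-\theta}}$, and let $t$ be the smallest integer such that $$t\ \ge\ \max\{9,\,1728\log(1/\tilde\delta)\}\,\frac{G^2D_1^2}{\epsilon_0^2}.$$ Then ASSG-c$(w_0,K,t,D_1,\epsilon_0)$ guarantees that, with probability $1-\delta$, $$F(w_K)-F_*\le 2\epsilon .$$ As a result, the iteration complexity of ASSG-c for achieving a $2\epsilon$-optimal solution with high probability $1-\delta$ is $$O\left(\frac{c^2G^2\,\lceil\log_2(\epsilon_0/\epsilon)\rceil\,\log(1/\delta)}{\epsilon^{2(1-\theta)}}\right),$$ provided $D_1=O\big(\frac{c\epsilon_0}{\epsilon^{1-\theta}}\big)$.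
   Context: Setting: $\mathcal K\subseteq\mathbb R^d$ is a closed convex set, $\xi$ is a random variable, $f(w;\xi)$ is a convex function of $w$, $F(w)=\mathbb E_\xi[f(w;\xi)]$, $F_*=\min_{w\in\mathcal K}F(w)$, and $\mathcal K_*=\arg\min_{w\in\mathcal K}F(w)$ is the (nonempty) optimal set. $\partial f(w;\xi)$ denotes a subgradient of $f(\cdot;\xi)$ at $w$. $\mathcal S_\epsilon=\{w\in\mathcal K:F(w)\le F_*+\epsilon\}$. $\mathcal B(w,r)$ is the Euclidean ball of radius $r$ centred at $w$ and $\Pi_{C}$ is Euclidean projection onto $C$. A point $w$ is $2\epsilon$-optimal if $F(w)-F_*\le2\epsilon$. Algorithm ASSG-c$(w_0,K,t,D_1,\epsilon_0)$: set $\eta_1=\epsilon_0/(3G^2)$. For $k=1,\dots,K$: let $w_1^k=w_{k-1}$; for $\tau=1,\dots,t-1$ let $w^k_{\tau+1}=\Pi_{\mathcal K\cap\mathcal B(w_{k-1},D_k)}[w^k_\tau-\eta_k\,\partial f(w^k_\tau;\xi^k_\tau)]$, where the $\xi_\tau^k$ are independent samples of $\xi$; let $w_k=\frac1t\sum_{\tau=1}^t w^k_\tau$, $\eta_{k+1}=\eta_k/2$, $D_{k+1}=D_k/2$. Output $w_K$.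
   Formalization: The printed O-bound with log(1/δ) fails for fixed δ as ε→0, since t involves log(K/δ); it is proved only when 1+log K = O(log(1/δ)), and in general with max(1, log(1/δ̃)) in place of log(1/δ). *)

theory Defs
  imports "HOL-Probability.Probability" "HOL-Library.Landau_Symbols"
begin

definition is_subgradient :: "('a::real_inner \<Rightarrow> real) \<Rightarrow> 'a \<Rightarrow> 'a \<Rightarrow> bool" where
  "is_subgradient h w v \<longleftrightarrow> (\<forall>u. h w + v \<bullet> (u - w) \<le> h u)"

text \<open>The measure \<open>P\<close> is the law of the random variable \<open>\<xi>\<close>.\<close>

definition expected_loss :: "'s measure \<Rightarrow> ('a \<Rightarrow> 's \<Rightarrow> real) \<Rightarrow> 'a \<Rightarrow> real" where
  "expected_loss P f w = (\<integral>s. f w s \<partial>P)"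

text \<open>The infimum is a minimum only if \<open>opt_set F \<K>\<close> is nonempty.\<close>

definition opt_val :: "('a \<Rightarrow> real) \<Rightarrow> 'a set \<Rightarrow> real" where
  "opt_val F \<K> = (INF w\<in>\<K>. F w)"

definition opt_set :: "('a \<Rightarrow> real) \<Rightarrow> 'a set \<Rightarrow> 'a set" where
  "opt_set F \<K> = {w. is_arg_min F (\<lambda>v. v \<in> \<K>) w}"

definition eps_sublevel :: "('a \<Rightarrow> real) \<Rightarrow> 'a set \<Rightarrow> real \<Rightarrow> 'a set" where
  "eps_sublevel F \<K> \<epsilon> = {w \<in> \<K>. F w \<le> opt_val F \<K> + \<epsilon>}"

text \<open>
  Projected stochastic subgradient steps with the oracle \<open>g\<close>, where \<open>g w s\<close> is the chosen
  subgradient of \<open>f(\<cdot>; s)\<close> at \<open>w\<close>. Iterates are counted from 0: \<open>ssg C g \<eta> x u n\<close> is the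
  iterate \<open>w\<^sub>\<tau>\<close> with \<open>\<tau> = n + 1\<close>. Samples are counted from 1, so that the step from
  \<open>w\<^sub>\<tau>\<close> to the next iterate uses \<open>x \<tau>\<close>.
\<close>

primrec ssg :: "'a::euclidean_space set \<Rightarrow> ('a \<Rightarrow> 's \<Rightarrow> 'a) \<Rightarrow> real \<Rightarrow> (nat \<Rightarrow> 's) \<Rightarrow> 'a \<Rightarrow> nat \<Rightarrow> 'a" where
  "ssg C g \<eta> x u 0 = u"
| "ssg C g \<eta> x u (Suc n) =
     closest_point C (ssg C g \<eta> x u n - \<eta> *\<^sub>R g (ssg C g \<eta> x u n) (x (Suc n)))"

text \<open>
  \<open>assg_stage \<K> g w0 D1 \<eta>1 t x k\<close> is the output of stage \<open>k\<close>. After \<open>k\<close> halvings, stage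
  \<open>k + 1\<close> uses the step size \<open>\<eta>1 / 2 ^ k\<close> and the radius \<open>D1 / 2 ^ k\<close>; its samples
  are \<open>x (k + 1) 1, \<dots>, x (k + 1) (t - 1)\<close>.
\<close>

primrec assg_stage ::
  "'a::euclidean_space set \<Rightarrow> ('a \<Rightarrow> 's \<Rightarrow> 'a) \<Rightarrow> 'a \<Rightarrow> real \<Rightarrow> real \<Rightarrow> nat \<Rightarrow> (nat \<Rightarrow> nat \<Rightarrow> 's) \<Rightarrow> nat \<Rightarrow> 'a" where
  "assg_stage \<K> g w0 D1 \<eta>1 t x 0 = w0"
| "assg_stage \<K> g w0 D1 \<eta>1 t x (Suc k) =
     (let u = assg_stage \<K> g w0 D1 \<eta>1 t x k
      in (1 / real t) *\<^sub>R
           (\<Sum>n<t. ssg (\<K> \<inter> cball u (D1 / 2 ^ k)) g (\<eta>1 / 2 ^ k) (x (Suc k)) u n))"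

definition assg_c ::
  "'a::euclidean_space set \<Rightarrow> ('a \<Rightarrow> 's \<Rightarrow> 'a) \<Rightarrow> real \<Rightarrow> 'a \<Rightarrow> nat \<Rightarrow> nat \<Rightarrow> real \<Rightarrow> real \<Rightarrow> (nat \<Rightarrow> nat \<Rightarrow> 's) \<Rightarrow> 'a" where
  "assg_c \<K> g G w0 K t D1 \<epsilon>0 x = assg_stage \<K> g w0 D1 (\<epsilon>0 / (3 * G\<^sup>2)) t x K"

text \<open>
  If \<open>\<epsilon>0 \<le> \<epsilon>\<close>, including \<open>\<epsilon>0 = 0\<close> (where \<open>log 2 0 = 0\<close>), then there are no stages and
  the output is \<open>w0\<close>, which is already \<open>\<epsilon>\<close>-optimal.
\<close>

definition assg_num_stages :: "real \<Rightarrow> real \<Rightarrow> nat" where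
  "assg_num_stages \<epsilon>0 \<epsilon> = nat \<lceil>log 2 (\<epsilon>0 / \<epsilon>)\<rceil>"

definition assg_stage_length :: "real \<Rightarrow> real \<Rightarrow> real \<Rightarrow> real \<Rightarrow> real \<Rightarrow> nat" where
  "assg_stage_length G \<epsilon>0 \<epsilon> \<delta> D1 =
     (let \<delta>' = \<delta> / real (assg_num_stages \<epsilon>0 \<epsilon>)
      in LEAST t::nat. real t \<ge> max 9 (1728 * ln (1 / \<delta>')) * (G\<^sup>2 * D1\<^sup>2 / \<epsilon>0\<^sup>2))"

text \<open>The inner loop of each stage runs over \<open>\<tau> = 1, \<dots>, t - 1\<close>.\<close>

definition assg_iterations :: "real \<Rightarrow> real \<Rightarrow> real \<Rightarrow> real \<Rightarrow> real \<Rightarrow> nat" where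
  "assg_iterations G \<epsilon>0 \<epsilon> \<delta> D1 =
     (\<Sum>k\<in>{1..assg_num_stages \<epsilon>0 \<epsilon>}. card {1..<assg_stage_length G \<epsilon>0 \<epsilon> \<delta> D1})"

text \<open>
  The subgradient bound \<open>G\<close> is taken positive, since the initial step size divides by
  \<open>G\<^sup>2\<close>.
\<close>

definition assg_params ::
  "real \<Rightarrow> real \<Rightarrow> real \<Rightarrow> real \<Rightarrow> real \<Rightarrow> real \<Rightarrow> real \<Rightarrow> bool" where
  "assg_params G c \<theta> \<epsilon>0 \<epsilon> \<delta> D1 \<longleftrightarrow>
     G > 0 \<and> c > 0 \<and> 0 < \<theta> \<and> \<theta> \<le> 1 \<and> \<epsilon>0 \<ge> 0 \<and> \<epsilon> > 0 \<and> 0 < \<delta> \<and> \<delta> < 1 \<and>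
     D1 \<ge> c * \<epsilon>0 / \<epsilon> powr (1 - \<theta>)"

end

theory Submission
  imports Defs
begin

text \<open>
  Let \<open>e\<^sub>k = \<epsilon>0 / 2 ^ k\<close>. Stage by stage the run keeps the invariant that the gap of
  stage \<open>k\<close> is at most \<open>e\<^sub>k + \<epsilon>\<close>; after \<open>\<lceil>log 2 (\<epsilon>0 / \<epsilon>)\<rceil>\<close> stages
  this is at most \<open>2 * \<epsilon>\<close>.

  Progress is measured against the projection \<open>v\<close> of the starting point onto the
  \<open>\<epsilon>\<close>-sublevel set, not against an optimal point. The growth condition and convexity
  place \<open>v\<close> at distance at most \<open>c * e\<^sub>k / \<epsilon> powr (1 - \<theta>)\<close>, hence within the ball of the
  next stage (\<open>dist_eps_sublevel_le\<close>, which rests on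
  \<open>norm_diff_closest_point_sublevel_le\<close>). The regret bound of projected subgradient descent
  (\<open>average_gap_le\<close>), with the step size and length of the stage, then bounds the gap between
  the averaged iterate and \<open>v\<close> by \<open>e\<^sub>k / 3\<close> plus the average noise, so the stage succeeds
  if the average noise is at most \<open>e\<^sub>k / 6\<close> (\<open>stage_halves_gap\<close>).

  The noise terms of a stage are bounded martingale differences, because both the iterates and
  \<open>v\<close> stay in the ball. Their exponential moment is bounded sample by sample with Hoeffding's
  lemma, freezing the past and integrating over the new sample (\<open>potential_le\<close>). The
  moment is taken only over the event that \<open>v\<close> lies in the ball, which is settled before the
  stage begins. Chernoff's bound gives each stage a failure probability of at most
  \<open>\<delta> / K\<close>, and the failures of the \<open>K\<close> stages add up to \<open>\<delta>\<close> (\<open>prob_failure_le\<close>).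

  All these events must be measurable although the feasible set of a stage depends on the random
  point at which it starts. The projection onto \<open>\<K> \<inter> cball u r\<close> is jointly continuous in \<open>u\<close>
  and the projected point (\<open>continuous_on_closest_point_cball\<close>), so all iterates are Borel
  functions of the samples.

  The iteration count is at most \<open>K\<close> times the lower bound that defines the stage length, and
  the complexity bounds follow from a pointwise estimate with explicit constants (\<open>assg_iterations_le\<close>).
\<close>

section \<open>Projections onto balls and sublevel sets\<close>

text \<open>
  The balls of the algorithm are centred at random points, so the projection must be
  measurable in the centre as well as in the projected point; joint continuity gives this.
  The essential step is that every competitor \<open>z\<close> for the limiting ball is a limit of
  competitors for the approximating balls: pull \<open>z\<close> towards the centre \<open>u n\<close> just enough to
  enter the ball around \<open>u n\<close>; convexity keeps the pulled point in \<open>C\<close>.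
\<close>

lemma closed_graph_closest_point_cball:
  fixes C :: "'a::euclidean_space set"
  assumes C: "closed C" "convex C" and r: "r > 0"
    and u: "\<And>n. u n \<in> C" "u \<longlonglongrightarrow> a" and y: "y \<longlonglongrightarrow> b"
    and p: "(\<lambda>n. closest_point (C \<inter> cball (u n) r) (y n)) \<longlonglongrightarrow> p"
  shows "p = closest_point (C \<inter> cball a r) b"
proof -
  define q where "q n = closest_point (C \<inter> cball (u n) r) (y n)" for n
  have q: "q \<longlonglongrightarrow> p"
    using p by (simp add: q_def[abs_def])
  have ne: "closed (C \<inter> cball (u n) r)" "u n \<in> C \<inter> cball (u n) r" for n
    using C u r by auto
  have q_in: "q n \<in> C \<inter> cball (u n) r" for n
    unfolding q_def using ne by (metis closest_point_in_set empty_iff)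
  have "p \<in> C"
    using C(1) q q_in closed_sequentially by blast
  moreover have "dist a p \<le> r"
    by (rule LIMSEQ_le_const2[OF tendsto_dist[OF u(2) q]]) (use q_in in auto)
  ultimately have p_in: "p \<in> C \<inter> cball a r"
    by simp
  have "dist b p \<le> dist b z" if z: "z \<in> C \<inter> cball a r" for z
  proof -
    \<comment> \<open>The contraction factor is at most 1 and tends to 1, since the radius is positive.\<close>
    define \<alpha> where "\<alpha> n = r / (r + dist (u n) a)" for n
    define z' where "z' n = u n + \<alpha> n *\<^sub>R (z - u n)" for n
    have \<alpha>: "0 \<le> \<alpha> n" "\<alpha> n \<le> 1" for n
      using r by (auto simp: \<alpha>_def add_pos_nonneg)
    have "z' n \<in> C" for n
    proof -
      have "z' n = (1 - \<alpha> n) *\<^sub>R u n + \<alpha> n *\<^sub>R z"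
        by (simp add: z'_def algebra_simps)
      then show ?thesis
        using C(2) u z \<alpha>[of n] by (simp add: convexD_alt)
    qed
    moreover have "dist (u n) (z' n) \<le> r" for n
    proof -
      have "norm (z - u n) \<le> r + dist (u n) a"
        using z dist_triangle2[of z "u n" a]
        by (simp add: dist_norm dist_commute)
          (metis dist_commute dist_norm add_le_cancel_right order_trans)
      then have "\<alpha> n * norm (z - u n) \<le> \<alpha> n * (r + dist (u n) a)"
        by (intro mult_left_mono \<alpha>)
      also have "\<dots> = r"
        using r by (simp add: \<alpha>_def add_pos_nonneg less_imp_neq[symmetric])
      finally show ?thesis
        using \<alpha>[of n] by (simp add: z'_def dist_norm)
    qed
    ultimately have "dist (y n) (q n) \<le> dist (y n) (z' n)" for n
      unfolding q_def using ne by (intro closest_point_le) auto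
    moreover have "z' \<longlonglongrightarrow> a + (r / (r + dist a a)) *\<^sub>R (z - a)"
      unfolding z'_def[abs_def] \<alpha>_def
      by (intro tendsto_intros u) (use r in auto)
    then have "z' \<longlonglongrightarrow> z"
      using r by simp
    ultimately show ?thesis
      by (intro LIMSEQ_le[OF tendsto_dist[OF y q] tendsto_dist[OF y, of z' z]]) auto
  qed
  then show ?thesis
    using C p_in by (intro closest_point_unique) (auto intro: convex_Int closed_Int)
qed

text \<open>
  A map into a compact set with closed graph is continuous. The displacement from the centre
  has values in a fixed ball, which the projection itself has not.
\<close>

lemma continuous_on_closest_point_cball:
  fixes C :: "'a::euclidean_space set"
  assumes C: "closed C" "convex C" and r: "r > 0"
  shows "continuous_on (C \<times> UNIV) (\<lambda>(u, y). closest_point (C \<inter> cball u r) y)"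
proof -
  define h where "h = (\<lambda>(u, y). closest_point (C \<inter> cball u r) y - u)"
  have mem: "closest_point (C \<inter> cball u r) y \<in> C \<inter> cball u r" if "u \<in> C" for u y
    using that C r by (intro closest_point_in_set) auto
  have "continuous_on (C \<times> UNIV) h"
  proof (rule continuous_from_closed_graph[of "cball 0 r"])
    show "h \<in> C \<times> UNIV \<rightarrow> cball 0 r"
      using mem by (auto simp: h_def dist_norm norm_minus_commute)
    show "closed ((\<lambda>x. (x, h x)) ` (C \<times> UNIV))"
      unfolding closed_sequential_limits
    proof (intro allI impI, elim conjE)
      fix s l
      assume s: "\<forall>n. s n \<in> (\<lambda>x. (x, h x)) ` (C \<times> UNIV)" and l: "s \<longlonglongrightarrow> l"
      define u where "u n = fst (fst (s n))" for n
      define y where "y n = snd (fst (s n))" for n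
      obtain a b q where abq: "l = ((a, b), q)"
        by (metis surj_pair)
      have lim: "u \<longlonglongrightarrow> a" "y \<longlonglongrightarrow> b"
        using tendsto_fst[OF tendsto_fst[OF l]] tendsto_snd[OF tendsto_fst[OF l]]
        by (auto simp: abq u_def[abs_def] y_def[abs_def])
      have u: "u n \<in> C" and sn: "snd (s n) = closest_point (C \<inter> cball (u n) r) (y n) - u n" for n
        using s[rule_format, of n] by (auto simp: u_def y_def h_def)
      have "(\<lambda>n. snd (s n) + u n) \<longlonglongrightarrow> q + a"
        using tendsto_snd[OF l] lim(1) by (intro tendsto_add) (auto simp: abq)
      then have "q + a = closest_point (C \<inter> cball a r) b"
        using closed_graph_closest_point_cball[OF C r u lim] by (simp add: sn)
      moreover have "a \<in> C"
        using C(1) u lim(1) closed_sequentially by blast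
      ultimately show "l \<in> (\<lambda>x. (x, h x)) ` (C \<times> UNIV)"
        by (auto simp: abq h_def image_iff algebra_simps intro!: bexI[of _ "(a, b)"])
    qed
  qed simp
  then have "continuous_on (C \<times> UNIV) (\<lambda>x. h x + fst x)"
    by (intro continuous_intros)
  then show ?thesis
    by (simp add: h_def case_prod_unfold)
qed

lemma convex_sublevel:
  fixes F :: "'a::real_vector \<Rightarrow> real"
  assumes F: "convex_on C F"
  shows "convex {w \<in> C. F w \<le> b}"
proof (rule convexI)
  fix x y and s t :: real
  assume *: "x \<in> {w \<in> C. F w \<le> b}" "y \<in> {w \<in> C. F w \<le> b}" "0 \<le> s" "0 \<le> t" "s + t = 1"
  then have "s *\<^sub>R x + t *\<^sub>R y \<in> C"
    using convex_on_imp_convex[OF F] by (auto intro: convexD)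
  moreover have "F (s *\<^sub>R x + t *\<^sub>R y) \<le> s * F x + t * F y"
    using F * by (auto simp: convex_on_def)
  moreover have "\<dots> \<le> b"
    using * by (auto intro: convex_bound_le)
  ultimately show "s *\<^sub>R x + t *\<^sub>R y \<in> {w \<in> C. F w \<le> b}"
    by simp
qed

lemma norm_diff_scaleR_power2:
  fixes x y :: "'a::real_inner"
  shows "(norm (y - \<eta> *\<^sub>R x))\<^sup>2 = (norm y)\<^sup>2 - 2 * \<eta> * (x \<bullet> y) + \<eta>\<^sup>2 * (norm x)\<^sup>2"
  unfolding power2_norm_eq_inner
  by (simp add: inner_diff_left inner_diff_right inner_commute algebra_simps power2_eq_square[of \<eta>])

text \<open>
  A convex function cannot grow slowly outside a sublevel set: the segment from \<open>w\<close> to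
  \<open>p\<close> enters the sublevel set at the latest at the point \<open>z\<close> that divides it in the
  ratio \<open>\<Delta> : \<epsilon>\<close>. The projection \<open>v\<close> of \<open>w\<close> sees \<open>z\<close> under an obtuse
  angle, and expanding \<open>(w - v) \<bullet> (z - v) \<le> 0\<close> compares \<open>norm (w - v)\<close> with
  \<open>norm (v - p)\<close>.
\<close>

lemma norm_diff_closest_point_sublevel_le:
  fixes C :: "'a::euclidean_space set" and F :: "'a \<Rightarrow> real"
  assumes F: "convex_on C F" and S: "closed {w \<in> C. F w \<le> m + \<epsilon>}" (is "closed ?S")
    and p: "p \<in> C" "F p \<le> m" and w: "w \<in> C" "F w \<le> m + \<epsilon> + \<Delta>"
    and \<epsilon>: "\<epsilon> > 0" and \<Delta>: "\<Delta> \<ge> 0"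
  shows "\<epsilon> * norm (w - closest_point ?S w) \<le> \<Delta> * norm (closest_point ?S w - p)"
proof -
  define v where "v = closest_point ?S w"
  define \<alpha> where "\<alpha> = \<epsilon> / (\<epsilon> + \<Delta>)"
  define z where "z = (1 - \<alpha>) *\<^sub>R p + \<alpha> *\<^sub>R w"
  have \<alpha>: "0 \<le> \<alpha>" "\<alpha> \<le> 1" and \<alpha>_mult: "\<alpha> * (\<epsilon> + \<Delta>) = \<epsilon>" "(1 - \<alpha>) * (\<epsilon> + \<Delta>) = \<Delta>"
    using \<epsilon> \<Delta> by (auto simp: \<alpha>_def field_simps)
  have conv: "convex C"
    using F by (rule convex_on_imp_convex)
  have "F z \<le> (1 - \<alpha>) * F p + \<alpha> * F w"
    unfolding z_def using F \<alpha> p(1) w(1) by (intro convex_onD)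
  also have "\<dots> \<le> (1 - \<alpha>) * m + \<alpha> * (m + \<epsilon> + \<Delta>)"
    using \<alpha> p w by (intro add_mono mult_left_mono) auto
  also have "\<dots> = m + \<alpha> * (\<epsilon> + \<Delta>)"
    by (simp add: algebra_simps)
  finally have "z \<in> ?S"
    using conv p w \<alpha> \<alpha>_mult by (auto simp: z_def convexD_alt)
  moreover have "convex ?S"
    using F by (rule convex_sublevel)
  ultimately have "(w - v) \<bullet> (z - v) \<le> 0"
    unfolding v_def using S by (intro closest_point_dot)
  moreover have "z - v = (1 - \<alpha>) *\<^sub>R (p - v) + \<alpha> *\<^sub>R (w - v)"
    by (simp add: z_def algebra_simps)
  ultimately have "\<alpha> * (norm (w - v))\<^sup>2 \<le> (1 - \<alpha>) * ((w - v) \<bullet> (v - p))"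
    by (simp add: inner_simps power2_norm_eq_inner algebra_simps)
  also have "\<dots> \<le> (1 - \<alpha>) * (norm (w - v) * norm (v - p))"
    using \<alpha> by (intro mult_left_mono norm_cauchy_schwarz) auto
  finally have "norm (w - v) * (\<alpha> * norm (w - v)) \<le> norm (w - v) * ((1 - \<alpha>) * norm (v - p))"
    by (simp add: power2_eq_square ac_simps)
  then have "\<alpha> * norm (w - v) \<le> (1 - \<alpha>) * norm (v - p)"
    using \<alpha> by (cases "w = v") auto
  then have "(\<epsilon> + \<Delta>) * (\<alpha> * norm (w - v)) \<le> (\<epsilon> + \<Delta>) * ((1 - \<alpha>) * norm (v - p))"
    using \<epsilon> \<Delta> by (intro mult_left_mono) auto
  then show ?thesis
    using \<alpha>_mult by (simp add: v_def mult.assoc[symmetric] mult.commute[of "\<epsilon> + \<Delta>"])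
qed

section \<open>Projected subgradient steps\<close>

lemma ssg_in:
  assumes "closed C" "u \<in> C"
  shows "ssg C g \<eta> x u n \<in> C"
  using assms by (induction n) (auto intro: closest_point_in_set)

text \<open>
  The telescoping estimate of projected subgradient descent. The distance of the last iterate
  to \<open>v\<close> is kept: it pays for that iterate, which has no sample of its own.
\<close>

lemma ssg_regret:
  fixes C :: "'a::euclidean_space set"
  assumes C: "closed C" "convex C" and v: "v \<in> C" and \<eta>: "\<eta> > 0"
    and bd: "\<And>j. j < n \<Longrightarrow> norm (g (ssg C g \<eta> x u j) (x (Suc j))) \<le> G"
  shows "(\<Sum>j<n. g (ssg C g \<eta> x u j) (x (Suc j)) \<bullet> (ssg C g \<eta> x u j - v))
    \<le> ((norm (u - v))\<^sup>2 - (norm (ssg C g \<eta> x u n - v))\<^sup>2) / (2 * \<eta>) + n * \<eta> * G\<^sup>2 / 2"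
  using bd
proof (induction n)
  case (Suc n)
  let ?w = "ssg C g \<eta> x u n" and ?w' = "ssg C g \<eta> x u (Suc n)"
  let ?g = "g ?w (x (Suc n))"
  have "norm (?w' - v) \<le> norm (?w - \<eta> *\<^sub>R ?g - v)"
    using closest_point_lipschitz[OF C(2,1), of "?w - \<eta> *\<^sub>R ?g" v] v
    by (auto simp: closest_point_self dist_norm)
  then have "(norm (?w' - v))\<^sup>2 \<le> (norm (?w - \<eta> *\<^sub>R ?g - v))\<^sup>2"
    by (intro power_mono) auto
  also have "\<dots> = (norm (?w - v))\<^sup>2 - 2 * \<eta> * (?g \<bullet> (?w - v)) + \<eta>\<^sup>2 * (norm ?g)\<^sup>2"
    using norm_diff_scaleR_power2[of "?w - v" \<eta> ?g] by (simp add: algebra_simps)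
  also have "\<eta>\<^sup>2 * (norm ?g)\<^sup>2 \<le> \<eta>\<^sup>2 * G\<^sup>2"
    using Suc.prems[of n] by (intro mult_left_mono power_mono) auto
  finally have "2 * \<eta> * (?g \<bullet> (?w - v)) \<le> (norm (?w - v))\<^sup>2 - (norm (?w' - v))\<^sup>2 + \<eta>\<^sup>2 * G\<^sup>2"
    by linarith
  then have "?g \<bullet> (?w - v) \<le> ((norm (?w - v))\<^sup>2 - (norm (?w' - v))\<^sup>2 + \<eta>\<^sup>2 * G\<^sup>2) / (2 * \<eta>)"
    using \<eta> by (simp add: pos_le_divide_eq mult.commute)
  also have "\<dots> = ((norm (?w - v))\<^sup>2 - (norm (?w' - v))\<^sup>2) / (2 * \<eta>) + \<eta> * G\<^sup>2 / 2"
    using \<eta> by (simp add: add_divide_distrib power2_eq_square)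
  finally have step: "?g \<bullet> (?w - v) \<le> \<dots>" .
  have "(\<Sum>j<n. g (ssg C g \<eta> x u j) (x (Suc j)) \<bullet> (ssg C g \<eta> x u j - v))
      \<le> ((norm (u - v))\<^sup>2 - (norm (ssg C g \<eta> x u n - v))\<^sup>2) / (2 * \<eta>) + n * \<eta> * G\<^sup>2 / 2"
    using Suc by simp
  with step show ?case
    by (simp add: diff_divide_distrib algebra_simps add_divide_distrib del: ssg.simps)
qed simp

lemma inner_le_Young:
  fixes x y :: "'a::real_inner"
  assumes "\<eta> > 0"
  shows "x \<bullet> y \<le> (norm y)\<^sup>2 / (2 * \<eta>) + \<eta> * (norm x)\<^sup>2 / 2"
proof -
  have "0 \<le> (norm (y - \<eta> *\<^sub>R x))\<^sup>2"
    by simp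
  also have "\<dots> = (norm y)\<^sup>2 - 2 * \<eta> * (x \<bullet> y) + \<eta>\<^sup>2 * (norm x)\<^sup>2"
    by (rule norm_diff_scaleR_power2)
  finally show ?thesis
    using assms by (simp add: field_simps power2_eq_square)
qed

lemma ssg_cong:
  assumes "\<And>j. 1 \<le> j \<Longrightarrow> j \<le> n \<Longrightarrow> x j = x' j"
  shows "ssg C g \<eta> x u n = ssg C g \<eta> x' u n"
  using assms by (induction n) auto

lemma assg_stage_cong:
  assumes "\<And>i \<tau>. 1 \<le> i \<Longrightarrow> i \<le> k \<Longrightarrow> 1 \<le> \<tau> \<Longrightarrow> \<tau> < t \<Longrightarrow> x i \<tau> = x' i \<tau>"
  shows "assg_stage \<K> g w0 D1 \<eta>1 t x k = assg_stage \<K> g w0 D1 \<eta>1 t x' k"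
  using assms
proof (induction k)
  case (Suc k)
  have "assg_stage \<K> g w0 D1 \<eta>1 t x k = assg_stage \<K> g w0 D1 \<eta>1 t x' k"
    using Suc by simp
  moreover have "ssg C g \<eta> (x (Suc k)) u n = ssg C g \<eta> (x' (Suc k)) u n" if "n < t" for C \<eta> u n
    by (rule ssg_cong) (use Suc.prems that in auto)
  ultimately show ?case
    by (simp add: Let_def)
qed simp

section \<open>Stochastic convex objectives\<close>

locale stochastic_subgradient =
  fixes \<K> :: "'a::euclidean_space set" and P :: "'s measure"
    and f :: "'a \<Rightarrow> 's \<Rightarrow> real" and g :: "'a \<Rightarrow> 's \<Rightarrow> 'a" and G :: real
  assumes closed_feasible: "closed \<K>" and convex_feasible: "convex \<K>"
    and prob_space_P: "prob_space P"
    and convex_f: "\<And>s. s \<in> space P \<Longrightarrow> convex_on UNIV (\<lambda>w. f w s)"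
    and integrable_f: "\<And>w. w \<in> \<K> \<Longrightarrow> integrable P (f w)"
    and opt_nonempty: "opt_set (expected_loss P f) \<K> \<noteq> {}"
    and subgradient: "\<And>w s. w \<in> \<K> \<Longrightarrow> s \<in> space P \<Longrightarrow> is_subgradient (\<lambda>u. f u s) w (g w s)"
    and measurable_g [measurable]: "(\<lambda>(w, s). g w s) \<in> borel_measurable (borel \<Otimes>\<^sub>M P)"
    and G_pos: "G > 0"
    and norm_g_le: "\<And>w s. w \<in> \<K> \<Longrightarrow> s \<in> space P \<Longrightarrow> norm (g w s) \<le> G"
begin

abbreviation F :: "'a \<Rightarrow> real" where
  "F \<equiv> expected_loss P f"

abbreviation Fmin :: real where
  "Fmin \<equiv> opt_val F \<K>"

interpretation P: prob_space P
  by (rule prob_space_P)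

definition mean_g :: "'a \<Rightarrow> 'a" where
  "mean_g w = (\<integral>s. g w s \<partial>P)"

definition noise :: "'a \<Rightarrow> 'a \<Rightarrow> 's \<Rightarrow> real" where
  "noise v w s = (mean_g w - g w s) \<bullet> (w - v)"

lemma measurable_g_compose [measurable (raw)]:
  assumes "U \<in> borel_measurable Q" "Z \<in> measurable Q P"
  shows "(\<lambda>\<omega>. g (U \<omega>) (Z \<omega>)) \<in> borel_measurable Q"
  using measurable_compose[OF measurable_Pair[OF assms] measurable_g] by simp

lemma measurable_mean_g [measurable]: "mean_g \<in> borel_measurable borel"
  unfolding mean_g_def[abs_def] by measurable

lemma measurable_noise [measurable (raw)]:
  assumes [measurable]: "V \<in> borel_measurable Q" "U \<in> borel_measurable Q" "Z \<in> measurable Q P"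
  shows "(\<lambda>\<omega>. noise (V \<omega>) (U \<omega>) (Z \<omega>)) \<in> borel_measurable Q"
  unfolding noise_def by measurable

lemma integrable_g:
  assumes "w \<in> \<K>"
  shows "integrable P (g w)"
  by (rule P.integrable_const_bound[of _ G]) (use norm_g_le[OF assms] in auto)

lemma norm_mean_g_le:
  assumes w: "w \<in> \<K>"
  shows "norm (mean_g w) \<le> G"
proof -
  have "norm (mean_g w) \<le> (\<integral>s. norm (g w s) \<partial>P)"
    unfolding mean_g_def by (rule integral_norm_bound)
  also have "\<dots> \<le> (\<integral>s. G \<partial>P)"
    using norm_g_le[OF w] by (intro integral_mono integrable_norm integrable_g w) auto
  finally show ?thesis
    by (simp add: P.prob_space)
qed

lemma F_diff_le:
  assumes w: "w \<in> \<K>" and v: "v \<in> \<K>"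
  shows "F w - F v \<le> mean_g w \<bullet> (w - v)"
proof -
  have "F w + mean_g w \<bullet> (v - w) = (\<integral>s. f w s + g w s \<bullet> (v - w) \<partial>P)"
    using w by (simp add: expected_loss_def mean_g_def integrable_f integrable_g)
  also have "\<dots> \<le> F v"
    unfolding expected_loss_def
    using subgradient[OF w] w v
    by (intro integral_mono) (auto simp: is_subgradient_def integrable_f integrable_g)
  finally show ?thesis
    by (simp add: inner_diff_right)
qed

lemma continuous_on_F: "continuous_on \<K> F"
proof -
  have le: "F w - F v \<le> G * dist w v" if "w \<in> \<K>" "v \<in> \<K>" for w v
  proof -
    have "F w - F v \<le> norm (mean_g w) * norm (w - v)"
      using F_diff_le[OF that] norm_cauchy_schwarz order_trans by blast
    also have "\<dots> \<le> G * dist w v"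
      using norm_mean_g_le[OF that(1)] by (auto simp: dist_norm intro: mult_right_mono)
    finally show ?thesis .
  qed
  have "G-lipschitz_on \<K> F"
    using le[unfolded dist_norm] G_pos
    by (intro lipschitz_onI) (fastforce simp: dist_norm abs_le_iff norm_minus_commute)+
  then show ?thesis
    by (rule lipschitz_on_continuous_on)
qed

lemma convex_on_F: "convex_on \<K> F"
proof (rule convex_onI)
  fix t :: real and x y
  assume t: "0 < t" "t < 1" and x: "x \<in> \<K>" and y: "y \<in> \<K>"
  have "(1 - t) *\<^sub>R x + t *\<^sub>R y \<in> \<K>"
    using convex_feasible t x y by (simp add: convexD_alt)
  then have "F ((1 - t) *\<^sub>R x + t *\<^sub>R y) \<le> (\<integral>s. (1 - t) * f x s + t * f y s \<partial>P)"
    unfolding expected_loss_def using t x y convex_onD[OF convex_f, of _ t x y]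
    by (intro integral_mono integrable_f Bochner_Integration.integrable_add integrable_mult_right) auto
  also have "\<dots> = (1 - t) * F x + t * F y"
    using x y by (simp add: expected_loss_def integrable_f)
  finally show "F ((1 - t) *\<^sub>R x + t *\<^sub>R y) \<le> (1 - t) * F x + t * F y" .
qed (rule convex_feasible)

lemma F_eq_opt:
  assumes "w \<in> opt_set F \<K>"
  shows "F w = Fmin"
proof -
  have "F w \<le> F v" if "v \<in> \<K>" for v
    using assms that by (force simp: opt_set_def is_arg_min_def)
  then show ?thesis
    using assms unfolding opt_val_def
    by (intro antisym cINF_greatest cINF_lower2[of _ _ w]) (auto simp: opt_set_def is_arg_min_def bdd_below_def)
qed

lemma opt_le:
  assumes "v \<in> \<K>"
  shows "Fmin \<le> F v"
proof -
  obtain w where w: "w \<in> opt_set F \<K>"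
    using opt_nonempty by blast
  then have "F w \<le> F v"
    using assms by (force simp: opt_set_def is_arg_min_def)
  then show ?thesis
    using F_eq_opt[OF w] by simp
qed

lemma closed_sublevel: "closed {w \<in> \<K>. F w \<le> b}"
  using continuous_closed_preimage[OF continuous_on_F closed_feasible, of "{..b}"]
  by (simp add: vimage_def Int_def)

lemma opt_set_eq: "opt_set F \<K> = {w \<in> \<K>. F w \<le> Fmin}"
proof
  show "opt_set F \<K> \<subseteq> {w \<in> \<K>. F w \<le> Fmin}"
    using F_eq_opt by (auto simp: opt_set_def is_arg_min_def)
  show "{w \<in> \<K>. F w \<le> Fmin} \<subseteq> opt_set F \<K>"
    using opt_le by (force simp: opt_set_def is_arg_min_def)
qed

lemma
  shows closed_eps_sublevel: "closed (eps_sublevel F \<K> \<epsilon>)"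
    and convex_eps_sublevel: "convex (eps_sublevel F \<K> \<epsilon>)"
  unfolding eps_sublevel_def using closed_sublevel convex_sublevel[OF convex_on_F] by auto

lemma eps_sublevel_nonempty: "\<epsilon> \<ge> 0 \<Longrightarrow> eps_sublevel F \<K> \<epsilon> \<noteq> {}"
  using opt_nonempty by (force simp: opt_set_eq eps_sublevel_def)

text \<open>
  The local growth condition speaks about points of the \<open>\<epsilon>\<close>-sublevel set only. Applied to
  the projection of \<open>w\<close> it bounds the distance from there to the optimal set by
  \<open>c * \<epsilon> powr \<theta>\<close>, and convexity turns this into a growth bound that is linear in the
  excess \<open>\<Delta>\<close>, and so still useful far from the optimum. This is what allows the radius to
  be halved whenever the excess is.
\<close>

lemma dist_eps_sublevel_le:
  assumes growth: "\<And>w. w \<in> eps_sublevel F \<K> \<epsilon> \<Longrightarrow>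
      norm (w - closest_point (opt_set F \<K>) w) \<le> c * (F w - Fmin) powr \<theta>"
    and c: "c > 0" and \<theta>: "\<theta> > 0" and \<epsilon>: "\<epsilon> > 0" and \<Delta>: "\<Delta> \<ge> 0"
    and w: "w \<in> \<K>" "F w - Fmin \<le> \<Delta> + \<epsilon>"
  shows "norm (w - closest_point (eps_sublevel F \<K> \<epsilon>) w) \<le> c * \<Delta> / \<epsilon> powr (1 - \<theta>)"
proof -
  define v where "v = closest_point (eps_sublevel F \<K> \<epsilon>) w"
  define p where "p = closest_point (opt_set F \<K>) v"
  have v: "v \<in> eps_sublevel F \<K> \<epsilon>"
    unfolding v_def using \<epsilon> by (intro closest_point_in_set closed_eps_sublevel eps_sublevel_nonempty) auto
  have "p \<in> opt_set F \<K>"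
    unfolding p_def using opt_nonempty closed_sublevel[of "Fmin"]
    by (intro closest_point_in_set) (auto simp: opt_set_eq)
  then have p: "p \<in> \<K>" "F p \<le> Fmin"
    by (auto simp: opt_set_eq)
  have "norm (v - p) \<le> c * (F v - Fmin) powr \<theta>"
    unfolding p_def using growth v by blast
  also have "\<dots> \<le> c * \<epsilon> powr \<theta>"
    using v c \<theta> opt_le[of v] by (intro mult_left_mono powr_mono2) (auto simp: eps_sublevel_def)
  finally have "\<Delta> * norm (v - p) \<le> \<Delta> * (c * \<epsilon> powr \<theta>)"
    using \<Delta> by (intro mult_left_mono)
  moreover have "\<epsilon> * norm (w - v) \<le> \<Delta> * norm (v - p)"
    unfolding v_def eps_sublevel_def
    using w p \<epsilon> \<Delta> closed_sublevel by (intro norm_diff_closest_point_sublevel_le convex_on_F) auto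
  ultimately have "norm (w - v) \<le> c * \<Delta> * \<epsilon> powr \<theta> / \<epsilon>"
    using \<epsilon> by (simp add: pos_le_divide_eq ac_simps)
  also have "\<dots> = c * \<Delta> / \<epsilon> powr (1 - \<theta>)"
    using \<epsilon> by (simp add: powr_diff)
  finally show ?thesis
    by (simp add: v_def)
qed

text \<open>
  Since \<open>g w s \<bullet> (w - v)\<close> ranges over an interval of length \<open>2 * G * R\<close>, Hoeffding's lemma
  applies to the centred noise.
\<close>

lemma noise_mgf_le:
  assumes w: "w \<in> \<K>" and dist: "norm (w - v) \<le> R" and l: "l > 0"
  shows "(\<integral>\<^sup>+s. ennreal (exp (l * noise v w s)) \<partial>P) \<le> ennreal (exp (l\<^sup>2 * G\<^sup>2 * R\<^sup>2 / 2))"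
proof -
  define m where "m = mean_g w \<bullet> (w - v)"
  have "\<bar>g w s \<bullet> (w - v)\<bar> \<le> G * R" if "s \<in> space P" for s
  proof -
    have "\<bar>g w s \<bullet> (w - v)\<bar> \<le> norm (g w s) * norm (w - v)"
      by (rule Cauchy_Schwarz_ineq2)
    also have "\<dots> \<le> G * R"
      using norm_g_le[OF w that] dist G_pos by (intro mult_mono) auto
    finally show ?thesis .
  qed
  then have bounds: "noise v w s \<in> {m - G * R..m + G * R}" if "s \<in> space P" for s
    using that by (force simp: noise_def m_def inner_diff_left)
  interpret noise: interval_bounded_random_variable P "noise v w" "m - G * R" "m + G * R"
    by unfold_locales (use bounds in \<open>auto\<close>)
  have "P.expectation (noise v w) = 0"
    unfolding noise_def using w
    by (simp add: inner_diff_left integrable_g mean_g_def[symmetric] P.prob_space flip: integral_inner_left)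
       (simp add: mean_g_def integrable_g w)
  from noise.Hoeffdings_lemma_nn_integral_0[OF l this] show ?thesis
    by (simp add: power_mult_distrib ac_simps)
qed

end

section \<open>The iterates as random variables and the gap after one stage\<close>

context stochastic_subgradient
begin

lemma measurable_F:
  assumes [measurable]: "U \<in> borel_measurable Q" and "U \<in> space Q \<rightarrow> \<K>"
  shows "(\<lambda>\<omega>. F (U \<omega>)) \<in> borel_measurable Q"
  by (rule measurable_compose[OF measurable_restrict_space2[OF assms(2,1)]])
     (rule borel_measurable_continuous_on_restrict[OF continuous_on_F])

lemma measurable_closest_point_cball:
  assumes D: "D > 0" and U: "U \<in> borel_measurable Q" "U \<in> space Q \<rightarrow> \<K>"
    and Y: "Y \<in> borel_measurable Q"
  shows "(\<lambda>\<omega>. closest_point (\<K> \<inter> cball (U \<omega>) D) (Y \<omega>)) \<in> borel_measurable Q"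
proof -
  have "(\<lambda>\<omega>. (U \<omega>, Y \<omega>)) \<in> measurable Q (restrict_space borel (\<K> \<times> UNIV))"
    using U Y by (intro measurable_restrict_space2) (auto intro: borel_measurable_Pair)
  from measurable_compose[OF this borel_measurable_continuous_on_restrict[OF
      continuous_on_closest_point_cball[OF closed_feasible convex_feasible D]]]
  show ?thesis
    by simp
qed

lemma measurable_ssg:
  assumes D: "D > 0" and U [measurable]: "U \<in> borel_measurable Q" and UK: "U \<in> space Q \<rightarrow> \<K>"
    and Z: "\<And>j. 1 \<le> j \<Longrightarrow> j \<le> n \<Longrightarrow> Z j \<in> measurable Q P"
  shows "(\<lambda>\<omega>. ssg (\<K> \<inter> cball (U \<omega>) D) g \<eta> (\<lambda>j. Z j \<omega>) (U \<omega>) n) \<in> borel_measurable Q"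
  using Z
proof (induction n)
  case (Suc n)
  have [measurable]: "(\<lambda>\<omega>. ssg (\<K> \<inter> cball (U \<omega>) D) g \<eta> (\<lambda>j. Z j \<omega>) (U \<omega>) n) \<in> borel_measurable Q"
    using Suc by simp
  have [measurable]: "Z (Suc n) \<in> measurable Q P"
    using Suc.prems by simp
  show ?case
    unfolding ssg.simps by (rule measurable_closest_point_cball[OF D U UK]) measurable
qed simp

lemma ssg_in_cball:
  assumes "u \<in> \<K>" "D \<ge> 0"
  shows "ssg (\<K> \<inter> cball u D) g \<eta> x u n \<in> \<K> \<inter> cball u D"
  using assms closed_feasible by (intro ssg_in closed_Int) auto

lemma average_in_feasible:
  assumes "t > 0" "\<And>n. n < t \<Longrightarrow> W n \<in> \<K>"
  shows "(1 / real t) *\<^sub>R (\<Sum>n<t. W n) \<in> \<K>"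
  using convex_sum[OF _ convex_feasible, of "{..<t}" "\<lambda>_. 1 / real t" W] assms
  by (simp add: scaleR_sum_right)

lemma assg_stage_in:
  assumes "w0 \<in> \<K>" "D1 \<ge> 0" "t > 0"
  shows "assg_stage \<K> g w0 D1 \<eta>1 t x k \<in> \<K>"
proof (induction k)
  case (Suc k)
  show ?case
    unfolding assg_stage.simps Let_def
    by (rule average_in_feasible) (use ssg_in_cball[OF Suc] assms in auto)
qed (use assms in simp)

lemma measurable_assg_stage:
  assumes "w0 \<in> \<K>" "D1 > 0" "t > 0"
    and Z: "\<And>i \<tau>. 1 \<le> i \<Longrightarrow> i \<le> k \<Longrightarrow> 1 \<le> \<tau> \<Longrightarrow> \<tau> < t \<Longrightarrow> Z i \<tau> \<in> measurable Q P"
  shows "(\<lambda>\<omega>. assg_stage \<K> g w0 D1 \<eta>1 t (\<lambda>i \<tau>. Z i \<tau> \<omega>) k) \<in> borel_measurable Q"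
  using Z
proof (induction k)
  case (Suc k)
  show ?case
    unfolding assg_stage.simps Let_def
  proof (intro borel_measurable_scaleR borel_measurable_sum measurable_ssg)
    show "Z (Suc k) j \<in> measurable Q P" if "n \<in> {..<t}" "1 \<le> j" "j \<le> n" for n j
      using that Suc.prems by auto
  qed (use Suc assms assg_stage_in in auto)
qed simp

text \<open>
  There are \<open>t\<close> iterates but only \<open>t - 1\<close> sampled subgradients. For the last iterate the
  mean subgradient is used, which produces no noise term, and Young's inequality plays the role
  of the missing step. Its error \<open>(norm (W n - v))\<^sup>2 / (2 * \<eta>)\<close> cancels against the
  negative term of the regret bound, so the result is as if there had been \<open>t\<close> steps.
\<close>

lemma average_gap_le:
  fixes u v :: 'a and x :: "nat \<Rightarrow> 's" and D \<eta> :: real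
  defines "W \<equiv> ssg (\<K> \<inter> cball u D) g \<eta> x u"
  assumes u: "u \<in> \<K>" and v: "v \<in> \<K> \<inter> cball u D" and \<eta>: "\<eta> > 0" and t: "t > 0"
    and x: "\<And>j. 1 \<le> j \<Longrightarrow> j < t \<Longrightarrow> x j \<in> space P"
  shows "F ((1 / real t) *\<^sub>R (\<Sum>n<t. W n)) - F v
    \<le> D\<^sup>2 / (2 * \<eta> * t) + \<eta> * G\<^sup>2 / 2 + (\<Sum>j<t - 1. noise v (W j) (x (Suc j))) / t"
proof -
  obtain n where n: "t = Suc n"
    using t gr0_implies_Suc by blast
  have "D \<ge> 0"
    using v order_trans[OF zero_le_dist] by auto
  then have W: "W j \<in> \<K>" for j
    using ssg_in_cball[OF u] by (auto simp: W_def)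
  have uv: "norm (u - v) \<le> D"
    using v by (simp add: dist_norm)
  have gap: "F (W j) - F v \<le> g (W j) (x (Suc j)) \<bullet> (W j - v) + noise v (W j) (x (Suc j))" for j
    using F_diff_le[OF W[of j], of v] v by (simp add: noise_def inner_diff_left)
  have "(\<Sum>j<n. g (W j) (x (Suc j)) \<bullet> (W j - v))
      \<le> ((norm (u - v))\<^sup>2 - (norm (W n - v))\<^sup>2) / (2 * \<eta>) + n * \<eta> * G\<^sup>2 / 2"
    unfolding W_def
    by (rule ssg_regret)
       (use v \<eta> \<open>D \<ge> 0\<close> x n W norm_g_le closed_feasible convex_feasible in \<open>auto simp: W_def intro: convex_Int\<close>)
  then have "(\<Sum>j<n. F (W j) - F v)
      \<le> ((norm (u - v))\<^sup>2 - (norm (W n - v))\<^sup>2) / (2 * \<eta>) + n * \<eta> * G\<^sup>2 / 2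
        + (\<Sum>j<n. noise v (W j) (x (Suc j)))"
    using sum_mono[of "{..<n}" "\<lambda>j. F (W j) - F v", OF gap] by (simp add: sum.distrib)
  moreover have "F (W n) - F v \<le> (norm (W n - v))\<^sup>2 / (2 * \<eta>) + \<eta> * G\<^sup>2 / 2"
  proof -
    have "F (W n) - F v \<le> (norm (W n - v))\<^sup>2 / (2 * \<eta>) + \<eta> * (norm (mean_g (W n)))\<^sup>2 / 2"
      using F_diff_le[OF W[of n], of v] v inner_le_Young[OF \<eta>] order_trans by blast
    also have "\<dots> \<le> (norm (W n - v))\<^sup>2 / (2 * \<eta>) + \<eta> * G\<^sup>2 / 2"
      using norm_mean_g_le[OF W] \<eta> by (intro add_mono divide_right_mono mult_left_mono power_mono) auto
    finally show ?thesis .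
  qed
  ultimately have "(\<Sum>j<t. F (W j) - F v)
      \<le> (norm (u - v))\<^sup>2 / (2 * \<eta>) + t * \<eta> * G\<^sup>2 / 2 + (\<Sum>j<t - 1. noise v (W j) (x (Suc j)))"
    by (simp add: n diff_divide_distrib add_divide_distrib algebra_simps)
  also have "\<dots> \<le> D\<^sup>2 / (2 * \<eta>) + t * \<eta> * G\<^sup>2 / 2 + (\<Sum>j<t - 1. noise v (W j) (x (Suc j)))"
    using uv \<eta> by (intro add_mono divide_right_mono power_mono) auto
  finally have total: "(\<Sum>j<t. F (W j) - F v) \<le> \<dots>" .
  have "F (\<Sum>j<t. (1 / real t) *\<^sub>R W j) \<le> (\<Sum>j<t. (1 / real t) * F (W j))"
    using t W by (intro convex_on_sum[OF _ _ convex_on_F]) auto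
  then have "F ((1 / real t) *\<^sub>R (\<Sum>j<t. W j)) - F v \<le> (\<Sum>j<t. F (W j) - F v) / t"
    using t by (simp add: scaleR_sum_right sum_subtractf diff_divide_distrib sum_divide_distrib)
  also have "\<dots> \<le> (D\<^sup>2 / (2 * \<eta>) + t * \<eta> * G\<^sup>2 / 2 + (\<Sum>j<t - 1. noise v (W j) (x (Suc j)))) / t"
    using total t by (intro divide_right_mono) auto
  also have "\<dots> = D\<^sup>2 / (2 * \<eta> * t) + \<eta> * G\<^sup>2 / 2 + (\<Sum>j<t - 1. noise v (W j) (x (Suc j))) / t"
    using t by (simp add: add_divide_distrib)
  finally show ?thesis .
qed

text \<open>
  The step size and the stage length balance the three error terms: each is at most \<open>e / 6\<close>.
\<close>

lemma stage_halves_gap: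
  fixes u v :: 'a and x :: "nat \<Rightarrow> 's" and D e :: real
  defines "W \<equiv> ssg (\<K> \<inter> cball u D) g (e / (3 * G\<^sup>2)) x u"
  assumes u: "u \<in> \<K>" and v: "v \<in> \<K> \<inter> cball u D" and e: "e > 0" and t: "t > 0"
    and t_ge: "9 * (G\<^sup>2 * D\<^sup>2 / e\<^sup>2) \<le> real t"
    and x: "\<And>j. 1 \<le> j \<Longrightarrow> j < t \<Longrightarrow> x j \<in> space P"
    and noise_le: "(\<Sum>j<t - 1. noise v (W j) (x (Suc j))) \<le> t * e / 6"
  shows "F ((1 / real t) *\<^sub>R (\<Sum>n<t. W n)) - F v \<le> e / 2"
proof -
  have "D\<^sup>2 / (2 * (e / (3 * G\<^sup>2)) * t) \<le> e / 6"
    using t_ge e t G_pos by (simp add: field_simps power2_eq_square)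
  moreover have "e / (3 * G\<^sup>2) * G\<^sup>2 / 2 = e / 6"
    using G_pos by simp
  moreover have "(\<Sum>j<t - 1. noise v (W j) (x (Suc j))) / t \<le> e / 6"
    using noise_le t by (simp add: field_simps)
  moreover have "F ((1 / real t) *\<^sub>R (\<Sum>n<t. W n)) - F v \<le> D\<^sup>2 / (2 * (e / (3 * G\<^sup>2)) * t)
      + e / (3 * G\<^sup>2) * G\<^sup>2 / 2 + (\<Sum>j<t - 1. noise v (W j) (x (Suc j))) / t"
    unfolding W_def by (rule average_gap_le[OF u v _ t x]) (use e G_pos in auto)
  ultimately show ?thesis
    by linarith
qed

end

section \<open>Concentration of the noise within one stage\<close>

text \<open>
  One step of an exponential supermartingale without conditional expectations: if the past \<open>Y\<close>
  and the new sample \<open>Z\<close> are independent, \<open>Y\<close> may be frozen at \<open>y\<close> while integrating over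
  \<open>Z\<close>.
\<close>

lemma (in prob_space) nn_integral_indep_var_mult_le:
  assumes indep: "indep_var S Y T Z"
    and [measurable]: "\<Phi> \<in> borel_measurable S" "\<Psi> \<in> borel_measurable (S \<Otimes>\<^sub>M T)"
    and le: "\<And>y. y \<in> space S \<Longrightarrow> \<Phi> y * (\<integral>\<^sup>+\<omega>. \<Psi> (y, Z \<omega>) \<partial>M) \<le> c * \<Phi> y"
  shows "(\<integral>\<^sup>+\<omega>. \<Phi> (Y \<omega>) * \<Psi> (Y \<omega>, Z \<omega>) \<partial>M) \<le> c * (\<integral>\<^sup>+\<omega>. \<Phi> (Y \<omega>) \<partial>M)"
proof -
  have [measurable]: "Y \<in> measurable M S" "Z \<in> measurable M T"
    and eq: "distr M S Y \<Otimes>\<^sub>M distr M T Z = distr M (S \<Otimes>\<^sub>M T) (\<lambda>\<omega>. (Y \<omega>, Z \<omega>))"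
    using indep by (auto simp: indep_var_distribution_eq)
  interpret Z: prob_space "distr M T Z"
    by (rule prob_space_distr) simp
  have "(\<integral>\<^sup>+\<omega>. \<Phi> (Y \<omega>) * \<Psi> (Y \<omega>, Z \<omega>) \<partial>M)
      = (\<integral>\<^sup>+x. \<Phi> (fst x) * \<Psi> x \<partial>(distr M S Y \<Otimes>\<^sub>M distr M T Z))"
    unfolding eq by (subst nn_integral_distr) auto
  also have "\<dots> = (\<integral>\<^sup>+y. \<integral>\<^sup>+z. \<Phi> y * \<Psi> (y, z) \<partial>distr M T Z \<partial>distr M S Y)"
    by (subst Z.nn_integral_fst[symmetric]) auto
  also have "\<dots> \<le> (\<integral>\<^sup>+y. c * \<Phi> y \<partial>distr M S Y)"
    by (intro nn_integral_mono) (auto simp: nn_integral_cmult nn_integral_distr le)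
  also have "\<dots> = c * (\<integral>\<^sup>+\<omega>. \<Phi> (Y \<omega>) \<partial>M)"
    by (simp add: nn_integral_cmult nn_integral_distr)
  finally show ?thesis .
qed

text \<open>
  A run of all stages on random samples. The accuracy \<open>\<epsilon>\<close> enters only through the comparison
  points: stage \<open>k + 1\<close> is compared with the projection of its starting point onto the
  \<open>\<epsilon>\<close>-sublevel set.

  The quantities below are functions of an arbitrary sample array \<open>x\<close>, so that they can be
  evaluated both on the samples \<open>X\<close> and on a history that records only part of them.
\<close>

locale assg_run = stochastic_subgradient \<K> P f g G + M: prob_space M
  for \<K> :: "'a::euclidean_space set" and P :: "'s measure" and f g G and M :: "'w measure" +
  fixes X :: "nat \<Rightarrow> nat \<Rightarrow> 'w \<Rightarrow> 's" and K t :: nat and w0 :: 'a and D1 \<eta>1 \<epsilon> :: real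
  assumes indep_X: "M.indep_vars (\<lambda>_. P) (\<lambda>(k, \<tau>). X k \<tau>) ({1..K} \<times> {1..<t})"
    and distr_X: "\<And>k \<tau>. k \<in> {1..K} \<Longrightarrow> \<tau> \<in> {1..<t} \<Longrightarrow> distr M P (X k \<tau>) = P"
    and w0_in: "w0 \<in> \<K>" and D1_pos: "D1 > 0" and t_pos: "t > 0" and \<epsilon>_nonneg: "\<epsilon> \<ge> 0"
begin

definition stage :: "(nat \<Rightarrow> nat \<Rightarrow> 's) \<Rightarrow> nat \<Rightarrow> 'a" where
  "stage x k = assg_stage \<K> g w0 D1 \<eta>1 t x k"

definition target :: "(nat \<Rightarrow> nat \<Rightarrow> 's) \<Rightarrow> nat \<Rightarrow> 'a" where
  "target x k = closest_point (eps_sublevel F \<K> \<epsilon>) (stage x k)"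

definition iterate :: "(nat \<Rightarrow> nat \<Rightarrow> 's) \<Rightarrow> nat \<Rightarrow> nat \<Rightarrow> 'a" where
  "iterate x k n = ssg (\<K> \<inter> cball (stage x k) (D1 / 2 ^ k)) g (\<eta>1 / 2 ^ k) (x (Suc k)) (stage x k) n"

definition noise_sum :: "(nat \<Rightarrow> nat \<Rightarrow> 's) \<Rightarrow> nat \<Rightarrow> nat \<Rightarrow> real" where
  "noise_sum x k n = (\<Sum>j<n. noise (target x k) (iterate x k j) (x (Suc k) (Suc j)))"

definition reachable :: "(nat \<Rightarrow> nat \<Rightarrow> 's) \<Rightarrow> nat \<Rightarrow> bool" where
  "reachable x k \<longleftrightarrow> norm (stage x k - target x k) \<le> D1 / 2 ^ k"

text \<open>
  The indices of the samples used before step \<open>n + 1\<close> of stage \<open>k + 1\<close>.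
\<close>

definition past :: "nat \<Rightarrow> nat \<Rightarrow> (nat \<times> nat) set" where
  "past k n = {1..k} \<times> {1..<t} \<union> {Suc k} \<times> {1..n}"

text \<open>
  The exponential moment is restricted to the event that the comparison point lies within the
  current ball. Only there is the noise bounded in terms of the radius, and the event is decided
  by the earlier stages, so it does not disturb the independence of the new samples.
\<close>

definition potential :: "real \<Rightarrow> (nat \<Rightarrow> nat \<Rightarrow> 's) \<Rightarrow> nat \<Rightarrow> nat \<Rightarrow> ennreal" where
  "potential l x k n = (if reachable x k then ennreal (exp (l * noise_sum x k n)) else 0)"

lemma stage_0: "stage x 0 = w0"
  by (simp add: stage_def)

lemma stage_Suc: "stage x (Suc k) = (1 / real t) *\<^sub>R (\<Sum>n<t. iterate x k n)"
  by (simp add: stage_def iterate_def Let_def)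

lemma stage_in: "stage x k \<in> \<K>"
  unfolding stage_def using w0_in D1_pos t_pos by (intro assg_stage_in) auto

lemma target_in: "target x k \<in> eps_sublevel F \<K> \<epsilon>"
  unfolding target_def using \<epsilon>_nonneg
  by (intro closest_point_in_set closed_eps_sublevel eps_sublevel_nonempty)

lemma iterate_in: "iterate x k n \<in> \<K> \<inter> cball (stage x k) (D1 / 2 ^ k)"
  unfolding iterate_def using stage_in D1_pos by (intro ssg_in_cball) auto

lemma
  assumes "\<And>i \<tau>. (i, \<tau>) \<in> past k n \<Longrightarrow> x i \<tau> = x' i \<tau>"
  shows stage_cong: "stage x k = stage x' k"
    and iterate_cong: "m \<le> n \<Longrightarrow> iterate x k m = iterate x' k m"
    and potential_cong: "potential l x k n = potential l x' k n"
proof -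
  show stage: "stage x k = stage x' k"
    unfolding stage_def by (rule assg_stage_cong) (use assms in \<open>auto simp: past_def\<close>)
  show iterate: "iterate x k m = iterate x' k m" if "m \<le> n" for m
    unfolding iterate_def stage by (rule ssg_cong) (use assms that in \<open>auto simp: past_def\<close>)
  have "noise_sum x k n = noise_sum x' k n"
    unfolding noise_sum_def target_def stage
    by (intro sum.cong) (use assms in \<open>auto simp: past_def iterate\<close>)
  then show "potential l x k n = potential l x' k n"
    by (simp add: potential_def reachable_def target_def stage)
qed

lemma
  assumes k: "k < K" and Z: "\<And>i \<tau>. (i, \<tau>) \<in> past k n \<Longrightarrow> Z i \<tau> \<in> measurable Q P"
  shows measurable_stage: "(\<lambda>\<omega>. stage (\<lambda>i \<tau>. Z i \<tau> \<omega>) k) \<in> borel_measurable Q"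
    and measurable_target: "(\<lambda>\<omega>. target (\<lambda>i \<tau>. Z i \<tau> \<omega>) k) \<in> borel_measurable Q"
    and measurable_iterate: "m \<le> n \<Longrightarrow> (\<lambda>\<omega>. iterate (\<lambda>i \<tau>. Z i \<tau> \<omega>) k m) \<in> borel_measurable Q"
    and measurable_noise_sum: "(\<lambda>\<omega>. noise_sum (\<lambda>i \<tau>. Z i \<tau> \<omega>) k n) \<in> borel_measurable Q"
    and measurable_reachable: "{\<omega> \<in> space Q. reachable (\<lambda>i \<tau>. Z i \<tau> \<omega>) k} \<in> sets Q"
    and measurable_potential: "(\<lambda>\<omega>. potential l (\<lambda>i \<tau>. Z i \<tau> \<omega>) k n) \<in> borel_measurable Q"
proof -
  show stage [measurable]: "(\<lambda>\<omega>. stage (\<lambda>i \<tau>. Z i \<tau> \<omega>) k) \<in> borel_measurable Q"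
    unfolding stage_def
    by (intro measurable_assg_stage w0_in D1_pos t_pos Z) (auto simp: past_def)
  have "closest_point (eps_sublevel F \<K> \<epsilon>) \<in> borel_measurable borel"
    using \<epsilon>_nonneg convex_eps_sublevel closed_eps_sublevel eps_sublevel_nonempty
    by (intro borel_measurable_continuous_onI continuous_on_closest_point)
  then show [measurable]: "(\<lambda>\<omega>. target (\<lambda>i \<tau>. Z i \<tau> \<omega>) k) \<in> borel_measurable Q"
    unfolding target_def by measurable
  show iterate: "(\<lambda>\<omega>. iterate (\<lambda>i \<tau>. Z i \<tau> \<omega>) k m) \<in> borel_measurable Q" if "m \<le> n" for m
    unfolding iterate_def
    by (intro measurable_ssg stage) (use D1_pos stage_in that Z in \<open>auto simp: past_def\<close>)
  show [measurable]: "(\<lambda>\<omega>. noise_sum (\<lambda>i \<tau>. Z i \<tau> \<omega>) k n) \<in> borel_measurable Q"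
    unfolding noise_sum_def
    by (intro borel_measurable_sum measurable_noise iterate) (auto simp: past_def intro: Z)
  show [measurable]: "{\<omega> \<in> space Q. reachable (\<lambda>i \<tau>. Z i \<tau> \<omega>) k} \<in> sets Q"
    unfolding reachable_def by measurable
  show "(\<lambda>\<omega>. potential l (\<lambda>i \<tau>. Z i \<tau> \<omega>) k n) \<in> borel_measurable Q"
    unfolding potential_def by measurable
qed

lemma measurable_X: "k \<in> {1..K} \<Longrightarrow> \<tau> \<in> {1..<t} \<Longrightarrow> X k \<tau> \<in> measurable M P"
  using indep_X by (auto simp: M.indep_vars_def)

lemma past_subset: "k < K \<Longrightarrow> n < t \<Longrightarrow> past k n \<subseteq> {1..K} \<times> {1..<t}"
  by (auto simp: past_def)

definition history :: "(nat \<times> nat) set \<Rightarrow> 'w \<Rightarrow> nat \<times> nat \<Rightarrow> 's" where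
  "history A \<omega> = restrict (\<lambda>i. (case i of (k, \<tau>) \<Rightarrow> X k \<tau>) \<omega>) A"

lemma indep_history:
  assumes "k < K" "Suc n < t"
  shows "M.indep_var (PiM (past k n) (\<lambda>_. P)) (history (past k n))
    (PiM {(Suc k, Suc n)} (\<lambda>_. P)) (history {(Suc k, Suc n)})"
  unfolding history_def[abs_def]
  by (rule M.indep_var_restrict[OF indep_X]) (use assms in \<open>auto simp: past_def\<close>)

text \<open>
  Within the ball of radius \<open>D\<close> around the starting point, an iterate and the comparison
  point are at most \<open>2 * D\<close> apart, so Hoeffding's bound holds uniformly in the past.
\<close>

lemma potential_Suc_le:
  assumes k: "k < K" and n: "Suc n < t" and l: "l > 0"
  defines "D \<equiv> D1 / 2 ^ k"
  shows "(\<integral>\<^sup>+\<omega>. potential l (\<lambda>i \<tau>. X i \<tau> \<omega>) k (Suc n) \<partial>M)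
    \<le> ennreal (exp (2 * l\<^sup>2 * G\<^sup>2 * D\<^sup>2)) * (\<integral>\<^sup>+\<omega>. potential l (\<lambda>i \<tau>. X i \<tau> \<omega>) k n \<partial>M)"
proof -
  define \<Phi> where "\<Phi> y = potential l (\<lambda>i \<tau>. y (i, \<tau>)) k n" for y
  define \<Psi> where "\<Psi> = (\<lambda>(y, z). ennreal (exp (l *
      noise (target (\<lambda>i \<tau>. y (i, \<tau>)) k) (iterate (\<lambda>i \<tau>. y (i, \<tau>)) k n) (z (Suc k, Suc n)))))"
  have eval: "history (past k n) \<omega> (i, \<tau>) = X i \<tau> \<omega>" if "(i, \<tau>) \<in> past k n" for i \<tau> \<omega>
    using that by (simp add: history_def)
  have \<Phi>_hist: "\<Phi> (history (past k n) \<omega>) = potential l (\<lambda>i \<tau>. X i \<tau> \<omega>) k n" for \<omega>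
    unfolding \<Phi>_def by (rule potential_cong) (simp add: eval)
  have "potential l (\<lambda>i \<tau>. X i \<tau> \<omega>) k (Suc n) = potential l (\<lambda>i \<tau>. X i \<tau> \<omega>) k n *
      ennreal (exp (l * noise (target (\<lambda>i \<tau>. X i \<tau> \<omega>) k) (iterate (\<lambda>i \<tau>. X i \<tau> \<omega>) k n) (X (Suc k) (Suc n) \<omega>)))" for \<omega>
    by (simp add: potential_def noise_sum_def distrib_left exp_add ennreal_mult)
  also have "\<dots> \<omega> = \<Phi> (history (past k n) \<omega>) * \<Psi> (history (past k n) \<omega>, history {(Suc k, Suc n)} \<omega>)" for \<omega>
  proof -
    have "stage (\<lambda>i \<tau>. history (past k n) \<omega> (i, \<tau>)) k = stage (\<lambda>i \<tau>. X i \<tau> \<omega>) k"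
      by (rule stage_cong[where n = n]) (simp add: eval)
    moreover have "iterate (\<lambda>i \<tau>. history (past k n) \<omega> (i, \<tau>)) k n = iterate (\<lambda>i \<tau>. X i \<tau> \<omega>) k n"
      by (rule iterate_cong[where n = n]) (simp_all add: eval)
    ultimately show ?thesis
      by (simp add: \<Phi>_hist \<Psi>_def target_def history_def[of "{_}"])
  qed
  finally have split: "potential l (\<lambda>i \<tau>. X i \<tau> \<omega>) k (Suc n)
      = \<Phi> (history (past k n) \<omega>) * \<Psi> (history (past k n) \<omega>, history {(Suc k, Suc n)} \<omega>)" for \<omega> .
  let ?S = "PiM (past k n) (\<lambda>_. P)" and ?T = "PiM {(Suc k, Suc n)} (\<lambda>_. P)"
  have "(\<integral>\<^sup>+\<omega>. \<Phi> (history (past k n) \<omega>) * \<Psi> (history (past k n) \<omega>, history {(Suc k, Suc n)} \<omega>) \<partial>M)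
      \<le> ennreal (exp (2 * l\<^sup>2 * G\<^sup>2 * D\<^sup>2)) * (\<integral>\<^sup>+\<omega>. \<Phi> (history (past k n) \<omega>) \<partial>M)"
  proof (rule M.nn_integral_indep_var_mult_le[OF indep_history[OF k n]])
    show "\<Phi> \<in> borel_measurable ?S"
      unfolding \<Phi>_def by (rule measurable_potential[OF k]) simp
    have "(\<lambda>q. iterate (\<lambda>i \<tau>. fst q (i, \<tau>)) k n) \<in> borel_measurable (?S \<Otimes>\<^sub>M ?T)"
      "(\<lambda>q. target (\<lambda>i \<tau>. fst q (i, \<tau>)) k) \<in> borel_measurable (?S \<Otimes>\<^sub>M ?T)"
      by (rule measurable_iterate[OF k, where n = n] measurable_target[OF k, where n = n]; simp)+
    then show "\<Psi> \<in> borel_measurable (?S \<Otimes>\<^sub>M ?T)"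
      unfolding \<Psi>_def case_prod_unfold by measurable
    show "\<Phi> y * (\<integral>\<^sup>+\<omega>. \<Psi> (y, history {(Suc k, Suc n)} \<omega>) \<partial>M)
        \<le> ennreal (exp (2 * l\<^sup>2 * G\<^sup>2 * D\<^sup>2)) * \<Phi> y" for y
    proof (cases "reachable (\<lambda>i \<tau>. y (i, \<tau>)) k")
      case True
      let ?x = "\<lambda>i \<tau>. y (i, \<tau>)"
      have w: "iterate ?x k n \<in> \<K>" "dist (stage ?x k) (iterate ?x k n) \<le> D"
        using iterate_in[of ?x k n] by (auto simp: D_def)
      have "norm (iterate ?x k n - target ?x k)
          \<le> norm (iterate ?x k n - stage ?x k) + norm (stage ?x k - target ?x k)"
        using norm_triangle_ineq[of "iterate ?x k n - stage ?x k" "stage ?x k - target ?x k"] by simp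
      also have "\<dots> \<le> D + D"
        using True w by (intro add_mono) (auto simp: reachable_def D_def dist_norm norm_minus_commute)
      finally have "norm (iterate ?x k n - target ?x k) \<le> 2 * D"
        by simp
      from noise_mgf_le[OF w(1) this l]
      have mgf: "(\<integral>\<^sup>+z. ennreal (exp (l * noise (target ?x k) (iterate ?x k n) z)) \<partial>P)
          \<le> ennreal (exp (2 * l\<^sup>2 * G\<^sup>2 * D\<^sup>2))"
        by (simp add: power_mult_distrib ac_simps)
      have i: "Suc k \<in> {1..K}" "Suc n \<in> {1..<t}"
        using k n by auto
      have "(\<integral>\<^sup>+\<omega>. \<Psi> (y, history {(Suc k, Suc n)} \<omega>) \<partial>M)
          = (\<integral>\<^sup>+z. ennreal (exp (l * noise (target ?x k) (iterate ?x k n) z)) \<partial>distr M P (X (Suc k) (Suc n)))"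
        using measurable_X[OF i] by (subst nn_integral_distr) (auto simp: \<Psi>_def history_def)
      also have "\<dots> \<le> ennreal (exp (2 * l\<^sup>2 * G\<^sup>2 * D\<^sup>2))"
        using mgf by (simp add: distr_X[OF i])
      finally have "\<Phi> y * (\<integral>\<^sup>+\<omega>. \<Psi> (y, history {(Suc k, Suc n)} \<omega>) \<partial>M)
          \<le> \<Phi> y * ennreal (exp (2 * l\<^sup>2 * G\<^sup>2 * D\<^sup>2))"
        by (rule mult_left_mono) simp
      then show ?thesis
        by (simp add: mult.commute)
    qed (simp add: \<Phi>_def potential_def)
  qed
  then show ?thesis
    by (simp add: split \<Phi>_hist)
qed

lemma potential_le:
  assumes k: "k < K" and l: "l > 0"
  defines "D \<equiv> D1 / 2 ^ k"
  shows "n < t \<Longrightarrow> (\<integral>\<^sup>+\<omega>. potential l (\<lambda>i \<tau>. X i \<tau> \<omega>) k n \<partial>M) \<le> ennreal (exp (n * (2 * l\<^sup>2 * G\<^sup>2 * D\<^sup>2)))"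
proof (induction n)
  case 0
  have "(\<integral>\<^sup>+\<omega>. potential l (\<lambda>i \<tau>. X i \<tau> \<omega>) k 0 \<partial>M) \<le> (\<integral>\<^sup>+\<omega>. 1 \<partial>M)"
    by (intro nn_integral_mono) (simp add: potential_def noise_sum_def)
  then show ?case
    by (simp add: M.emeasure_space_1)
next
  case (Suc n)
  have "(\<integral>\<^sup>+\<omega>. potential l (\<lambda>i \<tau>. X i \<tau> \<omega>) k (Suc n) \<partial>M)
      \<le> ennreal (exp (2 * l\<^sup>2 * G\<^sup>2 * D\<^sup>2)) * (\<integral>\<^sup>+\<omega>. potential l (\<lambda>i \<tau>. X i \<tau> \<omega>) k n \<partial>M)"
    unfolding D_def using Suc.prems k l by (intro potential_Suc_le)
  also have "\<dots> \<le> ennreal (exp (2 * l\<^sup>2 * G\<^sup>2 * D\<^sup>2)) * ennreal (exp (n * (2 * l\<^sup>2 * G\<^sup>2 * D\<^sup>2)))"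
    using Suc by (intro mult_left_mono) auto
  also have "\<dots> = ennreal (exp (Suc n * (2 * l\<^sup>2 * G\<^sup>2 * D\<^sup>2)))"
    by (simp add: ennreal_mult[symmetric] exp_add[symmetric] algebra_simps)
  finally show ?case .
qed

text \<open>
  Chernoff's bound, by Markov's inequality for the potential.
\<close>

lemma prob_noise_sum_le:
  assumes k: "k < K" and l: "l > 0" and n: "n < t"
  defines "D \<equiv> D1 / 2 ^ k"
  shows "M.prob {\<omega> \<in> space M. reachable (\<lambda>i \<tau>. X i \<tau> \<omega>) k \<and> a < noise_sum (\<lambda>i \<tau>. X i \<tau> \<omega>) k n}
    \<le> exp (n * (2 * l\<^sup>2 * G\<^sup>2 * D\<^sup>2) - l * a)" (is "M.prob ?A \<le> _")
proof -
  have X: "X i \<tau> \<in> measurable M P" if "(i, \<tau>) \<in> past k n" for i \<tau>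
    using that past_subset[OF k n] measurable_X by auto
  have [measurable]: "?A \<in> sets M"
    using measurable_reachable[OF k X] measurable_noise_sum[OF k X] by measurable
  have "ennreal (exp (l * a)) * emeasure M ?A = (\<integral>\<^sup>+\<omega>. ennreal (exp (l * a)) * indicator ?A \<omega> \<partial>M)"
    by (simp add: nn_integral_cmult_indicator)
  also have "\<dots> \<le> (\<integral>\<^sup>+\<omega>. potential l (\<lambda>i \<tau>. X i \<tau> \<omega>) k n \<partial>M)"
    using l by (intro nn_integral_mono) (auto simp: potential_def indicator_def intro!: ennreal_leI)
  also have "\<dots> \<le> ennreal (exp (n * (2 * l\<^sup>2 * G\<^sup>2 * D\<^sup>2)))"
    unfolding D_def using k l n by (rule potential_le)
  finally have "exp (l * a) * M.prob ?A \<le> exp (n * (2 * l\<^sup>2 * G\<^sup>2 * D\<^sup>2))"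
    by (simp add: M.emeasure_eq_measure ennreal_mult[symmetric])
  then show ?thesis
    by (simp add: exp_diff field_simps)
qed

end

section \<open>Failure probability of the stages\<close>

context assg_run
begin

text \<open>
  Each stage may fail with probability \<open>\<delta>'\<close>. If stage \<open>k\<close> succeeded, the comparison point
  lies in the ball of stage \<open>k + 1\<close>, so that stage can fail only through an unusually large
  noise sum. Scaling radius and excess together leaves \<open>\<rho> = G\<^sup>2 * D\<^sup>2 / e\<^sup>2\<close> unchanged, and so
  one stage length serves all stages.
\<close>

lemma prob_failure_le:
  fixes c \<theta> \<epsilon>0 \<delta>' :: real
  assumes growth: "\<And>w. w \<in> eps_sublevel F \<K> \<epsilon> \<Longrightarrow>
      norm (w - closest_point (opt_set F \<K>) w) \<le> c * (F w - Fmin) powr \<theta>"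
    and c: "c > 0" and \<theta>: "\<theta> > 0" and \<epsilon>: "\<epsilon> > 0" and \<epsilon>0: "\<epsilon>0 > 0"
    and \<eta>1: "\<eta>1 = \<epsilon>0 / (3 * G\<^sup>2)" and D1: "c * \<epsilon>0 / \<epsilon> powr (1 - \<theta>) \<le> D1"
    and w0: "F w0 - Fmin \<le> \<epsilon>0" and \<delta>': "0 < \<delta>'" "\<delta>' \<le> 1"
    and t: "max 9 (1728 * ln (1 / \<delta>')) * (G\<^sup>2 * D1\<^sup>2 / \<epsilon>0\<^sup>2) \<le> real t"
    and k: "k \<le> K"
  shows "M.prob {\<omega> \<in> space M. \<not> F (stage (\<lambda>i \<tau>. X i \<tau> \<omega>) k) - Fmin \<le> \<epsilon>0 / 2 ^ k + \<epsilon>} \<le> k * \<delta>'"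
  using k
proof (induction k)
  case 0
  have "{\<omega> \<in> space M. \<not> F (stage (\<lambda>i \<tau>. X i \<tau> \<omega>) 0) - Fmin \<le> \<epsilon>0 / 2 ^ 0 + \<epsilon>} = {}"
    using w0 \<epsilon> by (auto simp: stage_0)
  then show ?case
    by (simp only: measure_empty)
next
  case (Suc k)
  define e where "e = \<epsilon>0 / 2 ^ k"
  define D where "D = D1 / 2 ^ k"
  define \<rho> where "\<rho> = G\<^sup>2 * D\<^sup>2 / e\<^sup>2"
  define bad where "bad k \<omega> \<longleftrightarrow> \<not> F (stage (\<lambda>i \<tau>. X i \<tau> \<omega>) k) - Fmin \<le> \<epsilon>0 / 2 ^ k + \<epsilon>" for k \<omega>
  define noisy where "noisy \<omega> \<longleftrightarrow> reachable (\<lambda>i \<tau>. X i \<tau> \<omega>) k \<and>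
      t * e / 6 < noise_sum (\<lambda>i \<tau>. X i \<tau> \<omega>) k (t - 1)" for \<omega>
  have k: "k < K" and n: "t - 1 < t"
    using Suc.prems t_pos by auto
  have e: "e > 0" and D: "D > 0"
    using \<epsilon>0 D1_pos by (simp_all add: e_def D_def)
  have \<rho>: "\<rho> > 0"
    using e D G_pos by (simp add: \<rho>_def)
  have \<rho>_eq: "\<rho> = G\<^sup>2 * D1\<^sup>2 / \<epsilon>0\<^sup>2"
    by (simp add: \<rho>_def e_def D_def power_divide)
  have t_ge: "9 * \<rho> \<le> t" "1728 * ln (1 / \<delta>') * \<rho> \<le> t"
    using \<rho> by (rule_tac order_trans[OF _ t[folded \<rho>_eq]], intro mult_right_mono, auto)+
  have X: "X i \<tau> \<in> measurable M P" if "i \<le> Suc k" "1 \<le> i" "1 \<le> \<tau>" "\<tau> < t" for i \<tau>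
    using that Suc.prems measurable_X by auto
  have [measurable]: "(\<lambda>\<omega>. F (stage (\<lambda>i \<tau>. X i \<tau> \<omega>) k)) \<in> borel_measurable M"
    using stage_in unfolding stage_def
    by (intro measurable_F measurable_assg_stage w0_in D1_pos t_pos measurable_X) (use k in auto)
  have bad_sets: "{\<omega> \<in> space M. bad k \<omega>} \<in> sets M"
    unfolding bad_def by measurable
  have X_past: "X i \<tau> \<in> measurable M P" if "(i, \<tau>) \<in> past k (t - 1)" for i \<tau>
    using that past_subset[OF k n] measurable_X by auto
  have noisy_sets: "{\<omega> \<in> space M. noisy \<omega>} \<in> sets M"
    unfolding noisy_def
    using measurable_reachable[OF k X_past] measurable_noise_sum[OF k X_past] by measurable
  have sub: "{\<omega> \<in> space M. bad (Suc k) \<omega>} \<subseteq> {\<omega> \<in> space M. bad k \<omega>} \<union> {\<omega> \<in> space M. noisy \<omega>}"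
  proof (rule subsetI, rule ccontr)
    fix \<omega>
    let ?x = "\<lambda>i \<tau>. X i \<tau> \<omega>"
    assume \<omega>: "\<omega> \<in> {\<omega> \<in> space M. bad (Suc k) \<omega>}"
      and "\<omega> \<notin> {\<omega> \<in> space M. bad k \<omega>} \<union> {\<omega> \<in> space M. noisy \<omega>}"
    then have good: "F (stage ?x k) - Fmin \<le> e + \<epsilon>" and quiet: "\<not> noisy \<omega>" and sp: "\<omega> \<in> space M"
      by (auto simp: bad_def e_def)
    have "norm (stage ?x k - target ?x k) \<le> c * e / \<epsilon> powr (1 - \<theta>)"
      unfolding target_def using e \<epsilon> c \<theta> stage_in good growth by (intro dist_eps_sublevel_le) auto
    also have "\<dots> = (c * \<epsilon>0 / \<epsilon> powr (1 - \<theta>)) / 2 ^ k"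
      by (simp add: e_def)
    also have "\<dots> \<le> D"
      unfolding D_def using D1 by (intro divide_right_mono) auto
    finally have near: "norm (stage ?x k - target ?x k) \<le> D" .
    then have noise: "noise_sum ?x k (t - 1) \<le> t * e / 6"
      using quiet by (auto simp: noisy_def reachable_def D_def)
    have "\<eta>1 / 2 ^ k = e / (3 * G\<^sup>2)"
      by (simp add: e_def \<eta>1)
    then have iterate_eq: "iterate ?x k n
        = ssg (\<K> \<inter> cball (stage ?x k) D) g (e / (3 * G\<^sup>2)) (?x (Suc k)) (stage ?x k) n" for n
      by (simp add: iterate_def D_def)
    have "F (stage ?x (Suc k)) - F (target ?x k) \<le> e / 2"
      unfolding stage_Suc iterate_eq
    proof (rule stage_halves_gap)
      show "target ?x k \<in> \<K> \<inter> cball (stage ?x k) D"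
        using near target_in by (auto simp: eps_sublevel_def dist_norm)
      show "9 * (G\<^sup>2 * D\<^sup>2 / e\<^sup>2) \<le> real t"
        using t_ge by (simp add: \<rho>_def)
      show "?x (Suc k) j \<in> space P" if "1 \<le> j" "j < t" for j
        using X[of "Suc k" j] that sp by (auto intro: measurable_space)
      show "(\<Sum>j<t - 1. noise (target ?x k) (ssg (\<K> \<inter> cball (stage ?x k) D) g (e / (3 * G\<^sup>2))
          (?x (Suc k)) (stage ?x k) j) (?x (Suc k) (Suc j))) \<le> t * e / 6"
        using noise by (simp add: noise_sum_def iterate_eq)
    qed (use stage_in e t_pos in auto)
    moreover have "F (target ?x k) \<le> Fmin + \<epsilon>"
      using target_in by (auto simp: eps_sublevel_def)
    ultimately show False
      using \<omega> by (auto simp: bad_def e_def)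
  qed
  have "M.prob {\<omega> \<in> space M. noisy \<omega>} \<le> \<delta>'"
  proof -
    \<comment> \<open>This value minimizes the Chernoff exponent for \<open>t\<close> noise terms and threshold \<open>t * e / 6\<close>.\<close>
    define l where "l = e / (24 * G\<^sup>2 * D\<^sup>2)"
    have l: "l > 0"
      using e D G_pos by (simp add: l_def)
    have 1: "2 * l\<^sup>2 * G\<^sup>2 * D\<^sup>2 = 1 / (288 * \<rho>)" and 2: "l * e = 1 / (24 * \<rho>)"
      using e D G_pos by (simp_all add: l_def \<rho>_def field_simps power2_eq_square)
    have "(t - 1) * (2 * l\<^sup>2 * G\<^sup>2 * D\<^sup>2) - l * (t * e / 6) \<le> t * (1 / (288 * \<rho>)) - t * (l * e) / 6"
      unfolding 1 using \<rho> by (simp add: divide_right_mono mult.left_commute)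
    also have "\<dots> = - (t / (288 * \<rho>))"
      unfolding 2 by simp
    also have "\<dots> \<le> - (6 * ln (1 / \<delta>'))"
      using t_ge \<rho> by (simp add: field_simps)
    also have "\<dots> \<le> ln \<delta>'"
      using \<delta>' by (simp add: ln_div)
    finally have "exp ((t - 1) * (2 * l\<^sup>2 * G\<^sup>2 * D\<^sup>2) - l * (t * e / 6)) \<le> \<delta>'"
      using \<delta>' by (metis exp_le_cancel_iff exp_ln)
    then show ?thesis
      using prob_noise_sum_le[OF k l n, of "t * e / 6"] by (simp add: noisy_def D_def)
  qed
  moreover have "M.prob {\<omega> \<in> space M. bad k \<omega>} \<le> k * \<delta>'"
    using Suc unfolding bad_def by simp
  moreover have "M.prob {\<omega> \<in> space M. bad (Suc k) \<omega>}
      \<le> M.prob {\<omega> \<in> space M. bad k \<omega>} + M.prob {\<omega> \<in> space M. noisy \<omega>}"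
    by (rule order_trans[OF M.finite_measure_mono[OF sub] measure_Un_le])
       (use bad_sets noisy_sets in auto)
  ultimately show ?case
    unfolding bad_def[symmetric] by (simp add: distrib_right)
qed

end

section \<open>Number and length of the stages\<close>

lemma assg_num_stages_pos_imp:
  assumes "\<epsilon> > 0" "\<epsilon>0 \<ge> 0" "assg_num_stages \<epsilon>0 \<epsilon> > 0"
  shows "\<epsilon>0 > \<epsilon>"
proof (rule ccontr)
  assume "\<not> \<epsilon>0 > \<epsilon>"
  then have "log 2 (\<epsilon>0 / \<epsilon>) \<le> 0"
    using assms by (cases "\<epsilon>0 = 0") (auto simp: log_def divide_le_0_iff ln_le_zero_iff)
  then show False
    using assms(3) by (simp add: assg_num_stages_def)
qed

lemma initial_gap_halved_le:
  assumes "\<epsilon> > 0" "\<epsilon>0 > 0"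
  shows "\<epsilon>0 / 2 ^ assg_num_stages \<epsilon>0 \<epsilon> \<le> \<epsilon>"
proof -
  have "log 2 (\<epsilon>0 / \<epsilon>) \<le> real (assg_num_stages \<epsilon>0 \<epsilon>)"
    unfolding assg_num_stages_def by linarith
  then have "\<epsilon>0 / \<epsilon> \<le> 2 powr real (assg_num_stages \<epsilon>0 \<epsilon>)"
    using assms by (simp add: log_le_iff)
  then show ?thesis
    using assms by (simp add: powr_realpow field_simps)
qed

text \<open>
  The stage length exceeds its real lower bound by less than one, and a stage of length \<open>t\<close>
  takes \<open>t - 1\<close> steps.
\<close>

lemma
  fixes G \<epsilon>0 \<epsilon> \<delta> D1 :: real
  defines "b \<equiv> max 9 (1728 * ln (1 / (\<delta> / real (assg_num_stages \<epsilon>0 \<epsilon>)))) * (G\<^sup>2 * D1\<^sup>2 / \<epsilon>0\<^sup>2)"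
  shows assg_stage_length_ge: "b \<le> assg_stage_length G \<epsilon>0 \<epsilon> \<delta> D1"
    and assg_stage_length_le: "real (assg_stage_length G \<epsilon>0 \<epsilon> \<delta> D1 - 1) \<le> b"
proof -
  have eq: "assg_stage_length G \<epsilon>0 \<epsilon> \<delta> D1 = (LEAST t::nat. b \<le> real t)"
    by (simp add: assg_stage_length_def b_def Let_def)
  show "b \<le> assg_stage_length G \<epsilon>0 \<epsilon> \<delta> D1"
    unfolding eq using LeastI_ex[OF real_arch_simple[of b]] by simp
  have "0 \<le> max 9 (1728 * ln (1 / (\<delta> / real (assg_num_stages \<epsilon>0 \<epsilon>))))"
    by (simp add: le_max_iff_disj)
  then have "b \<ge> 0"
    unfolding b_def by (rule mult_nonneg_nonneg) simp
  show "real (assg_stage_length G \<epsilon>0 \<epsilon> \<delta> D1 - 1) \<le> b"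
  proof (cases "assg_stage_length G \<epsilon>0 \<epsilon> \<delta> D1")
    case (Suc m)
    then have "\<not> b \<le> real m"
      using not_less_Least[of m "\<lambda>t. b \<le> real t"] by (simp add: eq)
    then show ?thesis
      using Suc by simp
  qed (use \<open>b \<ge> 0\<close> in simp)
qed

text \<open>
  The factor \<open>\<epsilon>0\<^sup>2\<close> in the bound on \<open>D1\<^sup>2\<close> cancels against the one in the stage length;
  \<open>\<epsilon>0\<close> survives only in the number of stages. Without stages there is nothing to count.
\<close>

lemma assg_iterations_le:
  assumes params: "assg_params G c \<theta> \<epsilon>0 \<epsilon> \<delta> D1"
    and D1: "\<bar>D1\<bar> \<le> C * \<bar>c * \<epsilon>0 / \<epsilon> powr (1 - \<theta>)\<bar>"
  defines "K \<equiv> real (assg_num_stages \<epsilon>0 \<epsilon>)"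
  shows "real (assg_iterations G \<epsilon>0 \<epsilon> \<delta> D1)
    \<le> 1728 * C\<^sup>2 * (c\<^sup>2 * G\<^sup>2 * K * max 1 (ln (1 / (\<delta> / K))) / \<epsilon> powr (2 * (1 - \<theta>)))"
proof (cases "K = 0")
  case False
  then have \<epsilon>0: "\<epsilon>0 > 0" and \<epsilon>: "\<epsilon> > 0"
    using assg_num_stages_pos_imp[of \<epsilon> \<epsilon>0] params by (auto simp: K_def assg_params_def)
  define L where "L = max 1 (ln (1 / (\<delta> / K)))"
  have "D1\<^sup>2 \<le> (C * \<bar>c * \<epsilon>0 / \<epsilon> powr (1 - \<theta>)\<bar>)\<^sup>2"
    using power_mono[OF D1, of 2] by simp
  also have "\<dots> = C\<^sup>2 * c\<^sup>2 * \<epsilon>0\<^sup>2 / \<epsilon> powr (2 * (1 - \<theta>))"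
    using \<epsilon> by (simp add: power_mult_distrib power_divide powr_power mult.commute)
  finally have "D1\<^sup>2 / \<epsilon>0\<^sup>2 \<le> C\<^sup>2 * c\<^sup>2 / \<epsilon> powr (2 * (1 - \<theta>))"
    using \<epsilon>0 by (simp add: field_simps)
  then have D1_sq: "G\<^sup>2 * (D1\<^sup>2 / \<epsilon>0\<^sup>2) \<le> G\<^sup>2 * (C\<^sup>2 * c\<^sup>2 / \<epsilon> powr (2 * (1 - \<theta>)))"
    by (rule mult_left_mono) simp
  have "real (assg_iterations G \<epsilon>0 \<epsilon> \<delta> D1) = K * real (assg_stage_length G \<epsilon>0 \<epsilon> \<delta> D1 - 1)"
    by (simp add: assg_iterations_def K_def)
  also have "\<dots> \<le> K * (max 9 (1728 * ln (1 / (\<delta> / K))) * (G\<^sup>2 * D1\<^sup>2 / \<epsilon>0\<^sup>2))"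
    using assg_stage_length_le[of G \<epsilon>0 \<epsilon> \<delta> D1] by (intro mult_left_mono) (auto simp: K_def)
  also have "\<dots> \<le> K * ((1728 * L) * (G\<^sup>2 * (C\<^sup>2 * c\<^sup>2 / \<epsilon> powr (2 * (1 - \<theta>)))))"
    using D1_sq by (intro mult_left_mono mult_mono) (auto simp: L_def K_def)
  finally show ?thesis
    by (simp add: L_def ac_simps)
qed (simp add: assg_iterations_def K_def)

lemma max_ln_stages_le:
  fixes C \<delta> K :: real
  assumes \<delta>: "0 < \<delta>" "\<delta> < 1" and K: "K \<ge> 1" and C: "\<bar>1 + ln K\<bar> \<le> C * \<bar>ln (1 / \<delta>)\<bar>"
  shows "max 1 (ln (1 / (\<delta> / K))) \<le> (C + 1) * ln (1 / \<delta>)"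
proof -
  have "ln (1 / \<delta>) \<ge> 0" "ln K \<ge> 0"
    using \<delta> K by auto
  moreover have "ln (1 / (\<delta> / K)) = ln K + ln (1 / \<delta>)"
    using \<delta> K by (simp add: ln_div)
  ultimately show ?thesis
    using C by (simp add: distrib_right)
qed

lemma assg_iterations_bigo:
  fixes G c \<theta> \<epsilon>0 \<epsilon> \<delta> D1 :: "'i \<Rightarrow> real"
  assumes params: "\<And>i. assg_params (G i) (c i) (\<theta> i) (\<epsilon>0 i) (\<epsilon> i) (\<delta> i) (D1 i)"
    and D1: "D1 \<in> O[\<F>](\<lambda>i. c i * \<epsilon>0 i / \<epsilon> i powr (1 - \<theta> i))"
  defines "K \<equiv> (\<lambda>i. real (assg_num_stages (\<epsilon>0 i) (\<epsilon> i)))"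
    and "N \<equiv> (\<lambda>i. real (assg_iterations (G i) (\<epsilon>0 i) (\<epsilon> i) (\<delta> i) (D1 i)))"
  shows "N \<in> O[\<F>](\<lambda>i. (c i)\<^sup>2 * (G i)\<^sup>2 * K i * max 1 (ln (1 / (\<delta> i / K i))) / \<epsilon> i powr (2 * (1 - \<theta> i)))"
      (is "N \<in> O[\<F>](?R)")
    and "(\<lambda>i. 1 + ln (K i)) \<in> O[\<F>](\<lambda>i. ln (1 / \<delta> i)) \<Longrightarrow>
      N \<in> O[\<F>](\<lambda>i. (c i)\<^sup>2 * (G i)\<^sup>2 * K i * ln (1 / \<delta> i) / \<epsilon> i powr (2 * (1 - \<theta> i)))"
      (is "_ \<Longrightarrow> N \<in> O[\<F>](?R')")
proof -
  obtain C where C: "\<forall>\<^sub>F i in \<F>. norm (D1 i) \<le> C * norm (c i * \<epsilon>0 i / \<epsilon> i powr (1 - \<theta> i))"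
    using D1 by (auto elim: landau_o.bigE)
  show N: "N \<in> O[\<F>](?R)"
  proof (rule bigoI)
    show "\<forall>\<^sub>F i in \<F>. norm (N i) \<le> 1728 * C\<^sup>2 * norm (?R i)"
      using C
    proof eventually_elim
      case (elim i)
      have "\<bar>?R i\<bar> = ?R i"
        by (intro abs_of_nonneg divide_nonneg_nonneg mult_nonneg_nonneg) (auto simp: K_def)
      with assg_iterations_le[OF params, of i C] elim show ?case
        by (simp add: N_def K_def)
    qed
  qed
  assume "(\<lambda>i. 1 + ln (K i)) \<in> O[\<F>](\<lambda>i. ln (1 / \<delta> i))"
  then obtain B where B: "\<forall>\<^sub>F i in \<F>. norm (1 + ln (K i)) \<le> B * norm (ln (1 / \<delta> i))"
    by (auto elim: landau_o.bigE)
  have "?R \<in> O[\<F>](?R')"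
  proof (rule bigoI)
    show "\<forall>\<^sub>F i in \<F>. norm (?R i) \<le> (B + 1) * norm (?R' i)"
      using B
    proof eventually_elim
      case (elim i)
      show ?case
      proof (cases "K i = 0")
        case False
        then have "K i \<ge> 1"
          by (simp add: K_def)
        have \<delta>: "0 < \<delta> i" "\<delta> i < 1"
          using params[of i] by (auto simp: assg_params_def)
        define a where "a = (c i)\<^sup>2 * (G i)\<^sup>2 * K i / \<epsilon> i powr (2 * (1 - \<theta> i))"
        have a: "a \<ge> 0"
          by (simp add: a_def K_def)
        have "a * max 1 (ln (1 / (\<delta> i / K i))) \<le> a * ((B + 1) * ln (1 / \<delta> i))"
          using max_ln_stages_le[OF \<delta> \<open>K i \<ge> 1\<close>] elim a by (intro mult_left_mono) auto
        moreover have "norm (?R i) = a * max 1 (ln (1 / (\<delta> i / K i)))"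
          using a by (simp add: a_def abs_mult K_def)
        moreover have "norm (?R' i) = a * ln (1 / \<delta> i)"
          using a \<delta> by (simp add: a_def abs_mult K_def ln_div)
        ultimately show ?thesis
          by (simp add: ac_simps)
      qed simp
    qed
  qed
  with N show "N \<in> O[\<F>](?R')"
    by (rule landau_o.big_trans)
qed

section \<open>Convergence and iteration complexity\<close>

theorem theorem3:
  fixes \<K> :: "'a::euclidean_space set"
    and P :: "'s measure" and M :: "'w measure"
    and f :: "'a \<Rightarrow> 's \<Rightarrow> real" and g :: "'a \<Rightarrow> 's \<Rightarrow> 'a"
    and F :: "'a \<Rightarrow> real" and X :: "nat \<Rightarrow> nat \<Rightarrow> 'w \<Rightarrow> 's"
    and w0 :: 'a and G c \<theta> \<epsilon>0 \<epsilon> \<delta> D1 :: real and K t :: nat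
  assumes "closed \<K>" and "convex \<K>"
    and "prob_space P"
    and "\<forall>s\<in>space P. convex_on UNIV (\<lambda>w. f w s)"
    and "\<forall>w\<in>\<K>. integrable P (f w)"
    and "F = expected_loss P f"
    and "opt_set F \<K> \<noteq> {}"
    and "\<forall>w\<in>\<K>. \<forall>s\<in>space P. is_subgradient (\<lambda>u. f u s) w (g w s)"
    and "(\<lambda>(w, s). g w s) \<in> borel_measurable (borel \<Otimes>\<^sub>M P)"
    and "assg_params G c \<theta> \<epsilon>0 \<epsilon> \<delta> D1"
    and "w0 \<in> \<K>" and "F w0 - opt_val F \<K> \<le> \<epsilon>0"
    and "\<forall>w\<in>\<K>. \<forall>s\<in>space P. norm (g w s) \<le> G"
    and "\<forall>w\<in>eps_sublevel F \<K> \<epsilon>.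
           norm (w - closest_point (opt_set F \<K>) w) \<le> c * (F w - opt_val F \<K>) powr \<theta>"
    and "K = assg_num_stages \<epsilon>0 \<epsilon>"
    and "t = assg_stage_length G \<epsilon>0 \<epsilon> \<delta> D1"
    and "prob_space M"
    and "prob_space.indep_vars M (\<lambda>_. P) (\<lambda>(k, \<tau>). X k \<tau>) ({1..K} \<times> {1..<t})"
    and "\<forall>k\<in>{1..K}. \<forall>\<tau>\<in>{1..<t}. distr M P (X k \<tau>) = P"
  shows "measure M {\<omega> \<in> space M.
             F (assg_c \<K> g G w0 K t D1 \<epsilon>0 (\<lambda>k \<tau>. X k \<tau> \<omega>)) - opt_val F \<K> \<le> 2 * \<epsilon>} \<ge> 1 - \<delta>
    \<and> (\<forall>(\<F> :: 'i filter) G c \<theta> \<epsilon>0 \<epsilon> \<delta> D1.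
         (\<forall>i. assg_params (G i) (c i) (\<theta> i) (\<epsilon>0 i) (\<epsilon> i) (\<delta> i) (D1 i)) \<longrightarrow>
         D1 \<in> O[\<F>](\<lambda>i. c i * \<epsilon>0 i / \<epsilon> i powr (1 - \<theta> i)) \<longrightarrow>
         (let K = (\<lambda>i. real (assg_num_stages (\<epsilon>0 i) (\<epsilon> i)));
              N = (\<lambda>i. real (assg_iterations (G i) (\<epsilon>0 i) (\<epsilon> i) (\<delta> i) (D1 i)))
          in N \<in> O[\<F>](\<lambda>i. (c i)\<^sup>2 * (G i)\<^sup>2 * K i * max 1 (ln (1 / (\<delta> i / K i)))
                              / \<epsilon> i powr (2 * (1 - \<theta> i)))
           \<and> ((\<lambda>i. 1 + ln (K i)) \<in> O[\<F>](\<lambda>i. ln (1 / \<delta> i)) \<longrightarrow>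
              N \<in> O[\<F>](\<lambda>i. (c i)\<^sup>2 * (G i)\<^sup>2 * K i * ln (1 / \<delta> i)
                              / \<epsilon> i powr (2 * (1 - \<theta> i))))))"
proof (intro conjI allI impI)
  have params: "G > 0" "c > 0" "\<theta> > 0" "\<epsilon>0 \<ge> 0" "\<epsilon> > 0" "0 < \<delta>" "\<delta> < 1"
    and D1: "c * \<epsilon>0 / \<epsilon> powr (1 - \<theta>) \<le> D1"
    using assms(10) by (auto simp: assg_params_def)
  note F = assms(6)
  interpret stochastic_subgradient \<K> P f g G
    by (rule stochastic_subgradient.intro) (use assms(1-5,7-9,13) params in \<open>auto simp: F\<close>)
  interpret M: prob_space M
    by (rule assms(17))
  let ?w = "\<lambda>\<omega>. assg_c \<K> g G w0 K t D1 \<epsilon>0 (\<lambda>k \<tau>. X k \<tau> \<omega>)"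
  show "1 - \<delta> \<le> M.prob {\<omega> \<in> space M. F (?w \<omega>) - opt_val F \<K> \<le> 2 * \<epsilon>}"
  proof (cases "K = 0")
    case True
    then have "\<epsilon>0 / \<epsilon> \<le> 1 \<or> \<epsilon>0 = 0"
      using assms(15) params by (auto simp: assg_num_stages_def)
    then have "\<epsilon>0 \<le> \<epsilon>"
      using params by auto
    then have "{\<omega> \<in> space M. F (?w \<omega>) - opt_val F \<K> \<le> 2 * \<epsilon>} = space M"
      using assms(12) params True by (auto simp: assg_c_def)
    then show ?thesis
      using params by (simp add: M.prob_space)
  next
    case False
    then have \<epsilon>0: "\<epsilon>0 > 0"
      using assg_num_stages_pos_imp[of \<epsilon> \<epsilon>0] params assms(15) by auto
    define \<delta>' where "\<delta>' = \<delta> / K"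
    have \<delta>': "0 < \<delta>'" "\<delta>' \<le> 1" "K * \<delta>' = \<delta>"
      using params False by (auto simp: \<delta>'_def divide_le_eq)
    have D1_pos: "D1 > 0"
      using params \<epsilon>0 by (intro less_le_trans[OF _ D1]) simp
    have t_ge: "max 9 (1728 * ln (1 / \<delta>')) * (G\<^sup>2 * D1\<^sup>2 / \<epsilon>0\<^sup>2) \<le> real t"
      unfolding assms(16) \<delta>'_def assms(15) by (rule assg_stage_length_ge)
    have "0 < max 9 (1728 * ln (1 / \<delta>')) * (G\<^sup>2 * D1\<^sup>2 / \<epsilon>0\<^sup>2)"
      using params \<epsilon>0 D1_pos by (intro mult_pos_pos) (auto simp: less_max_iff_disj)
    then have "t > 0"
      using t_ge by linarith
    then interpret assg_run \<K> P f g G M X K t w0 D1 "\<epsilon>0 / (3 * G\<^sup>2)" \<epsilon>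
      using assms(11,18,19) params D1_pos by unfold_locales auto
    let ?fail = "{\<omega> \<in> space M. \<not> F (stage (\<lambda>i \<tau>. X i \<tau> \<omega>) K) - opt_val F \<K> \<le> \<epsilon>0 / 2 ^ K + \<epsilon>}"
    have "M.prob ?fail \<le> K * \<delta>'"
      unfolding F using assms(12,14) params \<epsilon>0 D1 \<delta>' t_ge
      by (intro prob_failure_le[where c = c and \<theta> = \<theta>]) (auto simp: F)
    then have fail: "M.prob ?fail \<le> \<delta>"
      using \<delta>' by simp
    have w: "?w \<omega> = stage (\<lambda>i \<tau>. X i \<tau> \<omega>) K" for \<omega>
      by (simp add: assg_c_def stage_def)
    have [measurable]: "(\<lambda>\<omega>. F (stage (\<lambda>i \<tau>. X i \<tau> \<omega>) K)) \<in> borel_measurable M"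
      unfolding F using stage_in unfolding stage_def
      by (intro measurable_F measurable_assg_stage w0_in D1_pos t_pos measurable_X) auto
    have "M.prob (space M - ?fail) = 1 - M.prob ?fail"
      by (rule M.prob_compl) measurable
    then have "1 - \<delta> \<le> M.prob (space M - ?fail)"
      using fail by simp
    also have "\<dots> \<le> M.prob {\<omega> \<in> space M. F (?w \<omega>) - opt_val F \<K> \<le> 2 * \<epsilon>}"
    proof (rule M.finite_measure_mono)
      show "space M - ?fail \<subseteq> {\<omega> \<in> space M. F (?w \<omega>) - opt_val F \<K> \<le> 2 * \<epsilon>}"
        using initial_gap_halved_le[OF params(5) \<epsilon>0] unfolding w assms(15)[symmetric] by auto
      show "{\<omega> \<in> space M. F (?w \<omega>) - opt_val F \<K> \<le> 2 * \<epsilon>} \<in> sets M"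
        unfolding w by measurable
    qed
    finally show ?thesis .
  qed
next
  fix \<F> :: "'i filter" and G c \<theta> \<epsilon>0 \<epsilon> \<delta> D1 :: "'i \<Rightarrow> real"
  assume params: "\<forall>i. assg_params (G i) (c i) (\<theta> i) (\<epsilon>0 i) (\<epsilon> i) (\<delta> i) (D1 i)"
    and D1: "D1 \<in> O[\<F>](\<lambda>i. c i * \<epsilon>0 i / \<epsilon> i powr (1 - \<theta> i))"
  from assg_iterations_bigo[OF params[rule_format] D1]
  show "let K = (\<lambda>i. real (assg_num_stages (\<epsilon>0 i) (\<epsilon> i)));
            N = (\<lambda>i. real (assg_iterations (G i) (\<epsilon>0 i) (\<epsilon> i) (\<delta> i) (D1 i)))
        in N \<in> O[\<F>](\<lambda>i. (c i)\<^sup>2 * (G i)\<^sup>2 * K i * max 1 (ln (1 / (\<delta> i / K i)))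
                              / \<epsilon> i powr (2 * (1 - \<theta> i)))
           \<and> ((\<lambda>i. 1 + ln (K i)) \<in> O[\<F>](\<lambda>i. ln (1 / \<delta> i)) \<longrightarrow>
              N \<in> O[\<F>](\<lambda>i. (c i)\<^sup>2 * (G i)\<^sup>2 * K i * ln (1 / \<delta> i)
                              / \<epsilon> i powr (2 * (1 - \<theta> i))))"
    unfolding Let_def by blast
qed

end
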